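(* Let $(X_0^{(i),a})_{i\ge 1}$ be i.i.d. $\mathbb{R}^d$-valued random variables with distribution $\bar\pi_0$, and let $W_k^{(i)}$, $k\ge 1$, $i\ge 1$, be independent standard Gaussian vectors, independent of the initial conditions. For each $M\ge 2$ let $X_k^{(i),f}$ ($k\ge1$), $X_k^{(i),a}$ ($k\ge0$), $i=1,\dots,M$, be the Ensemble Square Root Filter (ESRF) of size $M$ with transformation $\mathcal{T}$ satisfying (T1), (T2), initialized at $X_0^{(i),a}$, and let $\bar X_k^{(i),f},\bar X_k^{(i),a}$, $i\ge1$, be the copies of the mean-field process driven by $W_k^{(i)}$ with $\bar X_0^{(i),a}=X_0^{(i),a}$. Put $$D_k^{M,p,f/a}:=\mathbb{E}\Big[\frac1M\sum_{i=1}^M\big\|X_k^{(i),f/a}-\bar X_k^{(i),f/a}\big\|^p\Big]^{1/p}.$$ Assume that $\bar\pi_0$ has finite moments of every order $p\ge2$. Then for every $k$ (with $k\ge1$ for the superscript $f$ and $k\ge 0$ for the superscript $a$) and all $p\ge2$, $$\sup_{M\ge2}\sqrt{M}\,D_k^{M,p,f/a}<\infty.$$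
   Context: Setting. $B:\mathbb{R}^d\to\mathbb{R}^d$ is globally Lipschitz, $C$ is a matrix with $Q:=CC^T$ positive definite, $H\in\mathbb{R}^{q\times d}$, $R=\Gamma\Gamma^T\in\mathbb{R}^{q\times q}$ is symmetric positive definite. $Y_1,Y_2,\dots\in\mathbb{R}^q$ is the given observation sequence (a fixed realization of $Y_k=HX_k+\Gamma V_k$, where $X_k=B(X_{k-1})+CW_k$ and $V_k$ are independent Gaussians); all laws and expectations refer to the randomness of the ensemble only. $\|\cdot\|$ is the Euclidean norm of vectors and the spectral norm of matrices; $\mathbb{R}^{d\times d}_{sym,+}$ is the set of symmetric positive semidefinite matrices. Kalman gain: $\mathcal{K}(P):=PH^T(R+HPH^T)^{-1}\in\mathbb{R}^{d\times q}$ for $P\in\mathbb{R}^{d\times d}_{sym,+}$. Transformation: $\mathcal{T}:\mathbb{R}^{d\times d}_{sym,+}\to\mathbb{R}^{d\times d}$ is a map satisfying the square-root consistency condition $\mathcal{T}(P)P\mathcal{T}(P)^T=(\mathrm{Id}-\mathcal{K}(P)H)P$ for all $P$, and there are positive constants $\mathcal{C}^{\mathcal{T}},\mathcal{L}^{\mathcal{T}}$ such that for all $P,Q\in\mathbb{R}^{d\times d}_{sym,+}$: (T1) $\|\mathcal{T}(P)\|\le \mathcal{C}^{\mathcal{T}}(1+\|P\|)$; (T2) $\|\mathcal{T}(P)-\mathcal{T}(Q)\|\le\mathcal{L}^{\mathcal{T}}(1+\|P\|^2+\|Q\|^2)\|P-Q\|$. ESRF of size $M\ge2$ (the dependence on $M$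 is suppressed): for $k\ge1$, $i=1,\dots,M$, $X_k^{(i),f}=B(X_{k-1}^{(i),a})+CW_k^{(i)}$, $\bar x_k^f=\frac1M\sum_{i=1}^M X_k^{(i),f}$, $P_k^f=\frac1{M-1}\sum_{i=1}^M(X_k^{(i),f}-\bar x_k^f)(X_k^{(i),f}-\bar x_k^f)^T$, $\bar x_k^a=\bar x_k^f+\mathcal{K}(P_k^f)(Y_k-H\bar x_k^f)$, $X_k^{(i),a}=\bar x_k^a+\mathcal{T}(P_k^f)(X_k^{(i),f}-\bar x_k^f)$. Mean-field process: for $k\ge1$, $\bar X_k^{f}=B(\bar X_{k-1}^{a})+CW_k$, $\bar X_k^{a}=\bar m_k^a+\mathcal{T}(\bar P_k^f)(\bar X_k^{f}-\bar m_k^f)$, where $\bar m_k^f$ and $\bar P_k^f$ are the mean and covariance matrix of the distribution of $\bar X_k^f$ and $\bar m_k^a=\bar m_k^f+\mathcal{K}(\bar P_k^f)(Y_k-H\bar m_k^f)$. The copy $\bar X^{(i)}$ is obtained by replacing $W_k$ with $W_k^{(i)}$. *)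

theory Defs
  imports "HOL-Probability.Probability"
begin

text \<open>
  An element of \<^typ>\<open>real ^ 'n ^ 'm\<close> is a matrix with rows indexed by \<^typ>\<open>'m\<close> and columns by
  \<^typ>\<open>'n\<close>. The library norm on this type is the Frobenius norm, so the spectral norm
  is introduced separately.
\<close>

definition spectral_norm :: "real ^ 'n ^ 'm \<Rightarrow> real" where
  "spectral_norm A = onorm (\<lambda>x. A *v x)"

definition pos_semidef :: "real ^ 'n ^ 'n \<Rightarrow> bool" where
  "pos_semidef A \<longleftrightarrow> transpose A = A \<and> (\<forall>x. 0 \<le> x \<bullet> (A *v x))"

definition pos_def :: "real ^ 'n ^ 'n \<Rightarrow> bool" where
  "pos_def A \<longleftrightarrow> transpose A = A \<and> (\<forall>x. x \<noteq> 0 \<longrightarrow> 0 < x \<bullet> (A *v x))"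

definition outer :: "real ^ 'm \<Rightarrow> real ^ 'n \<Rightarrow> real ^ 'n ^ 'm" where
  "outer x y = (\<chi> i j. x $ i * y $ j)"

definition standard_gaussian :: "'w measure \<Rightarrow> ('w \<Rightarrow> real ^ 'n) \<Rightarrow> bool" where
  "standard_gaussian \<P> W \<longleftrightarrow>
     distributed \<P> lborel W (\<lambda>x. ennreal (\<Prod>i\<in>UNIV. std_normal_density (x $ i)))"

text \<open>
  The initial conditions and the noise vectors have different types, so their joint independence
  is the independence of the generated sigma-algebras, indexed by a disjoint sum.
\<close>

definition generated_events :: "'w measure \<Rightarrow> ('w \<Rightarrow> 'a::topological_space) \<Rightarrow> 'w set set" where
  "generated_events \<P> X = {X -` A \<inter> space \<P> | A. A \<in> sets borel}"

definition jointly_independent ::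
    "'w measure \<Rightarrow> ('i \<Rightarrow> 'w \<Rightarrow> 'a::topological_space) \<Rightarrow> 'i set
      \<Rightarrow> ('j \<Rightarrow> 'w \<Rightarrow> 'b::topological_space) \<Rightarrow> 'j set \<Rightarrow> bool" where
  "jointly_independent \<P> X I W J \<longleftrightarrow>
     (\<forall>i\<in>I. X i \<in> borel_measurable \<P>) \<and> (\<forall>j\<in>J. W j \<in> borel_measurable \<P>) \<and>
     prob_space.indep_sets \<P>
       (case_sum (\<lambda>i. generated_events \<P> (X i)) (\<lambda>j. generated_events \<P> (W j))) (I <+> J)"

definition kalman_gain :: "real ^ 'd ^ 'q \<Rightarrow> real ^ 'q ^ 'q \<Rightarrow> real ^ 'd ^ 'd \<Rightarrow> real ^ 'q ^ 'd" where
  "kalman_gain H R P = P ** transpose H ** matrix_inv (R + H ** P ** transpose H)"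

text \<open>The transformation is constrained on positive semidefinite matrices only.\<close>

definition sqrt_consistent ::
    "real ^ 'd ^ 'q \<Rightarrow> real ^ 'q ^ 'q \<Rightarrow> (real ^ 'd ^ 'd \<Rightarrow> real ^ 'd ^ 'd) \<Rightarrow> bool" where
  "sqrt_consistent H R T \<longleftrightarrow>
     (\<forall>P. pos_semidef P \<longrightarrow> T P ** P ** transpose (T P) = (mat 1 - kalman_gain H R P ** H) ** P)"

definition forecast_map ::
    "(real ^ 'd \<Rightarrow> real ^ 'd) \<Rightarrow> real ^ 'r ^ 'd \<Rightarrow> real ^ 'd \<Rightarrow> real ^ 'r \<Rightarrow> real ^ 'd" where
  "forecast_map B C x w = B x + C *v w"

text \<open>
  Update of a forecast \<open>x\<close> with the observation \<open>y\<close>, where \<open>m\<close> and \<open>P\<close> are the forecast mean and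
  covariance: empirical ones for the ensemble, those of the law for the mean-field process.
\<close>

definition analysis_map ::
    "real ^ 'd ^ 'q \<Rightarrow> real ^ 'q ^ 'q \<Rightarrow> (real ^ 'd ^ 'd \<Rightarrow> real ^ 'd ^ 'd) \<Rightarrow> real ^ 'q
      \<Rightarrow> real ^ 'd \<Rightarrow> real ^ 'd ^ 'd \<Rightarrow> real ^ 'd \<Rightarrow> real ^ 'd" where
  "analysis_map H R T y m P x = (m + kalman_gain H R P *v (y - H *v m)) + T P *v (x - m)"

definition ens_mean :: "nat \<Rightarrow> (nat \<Rightarrow> real ^ 'd) \<Rightarrow> real ^ 'd" where
  "ens_mean M x = (1 / real M) *\<^sub>R (\<Sum>i=1..M. x i)"

definition ens_cov :: "nat \<Rightarrow> (nat \<Rightarrow> real ^ 'd) \<Rightarrow> real ^ 'd ^ 'd" where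
  "ens_cov M x =
     (1 / (real M - 1)) *\<^sub>R (\<Sum>i=1..M. outer (x i - ens_mean M x) (x i - ens_mean M x))"

text \<open>
  The ensemble square root filter, along one realization \<open>x0 i\<close>, \<open>w k i\<close> of the initial ensemble
  and of the noise. Particles are numbered from 1 to \<open>M\<close>; only noise at times \<open>k \<ge> 1\<close> enters.
\<close>

primrec esrf_a ::
    "(real ^ 'd \<Rightarrow> real ^ 'd) \<Rightarrow> real ^ 'r ^ 'd \<Rightarrow> real ^ 'd ^ 'q \<Rightarrow> real ^ 'q ^ 'q
      \<Rightarrow> (real ^ 'd ^ 'd \<Rightarrow> real ^ 'd ^ 'd) \<Rightarrow> (nat \<Rightarrow> real ^ 'q) \<Rightarrow> nat
      \<Rightarrow> (nat \<Rightarrow> real ^ 'd) \<Rightarrow> (nat \<Rightarrow> nat \<Rightarrow> real ^ 'r) \<Rightarrow> nat \<Rightarrow> nat \<Rightarrow> real ^ 'd" where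
  "esrf_a B C H R T Y M x0 w 0 = x0"
| "esrf_a B C H R T Y M x0 w (Suc k) =
     (let xf = (\<lambda>i. forecast_map B C (esrf_a B C H R T Y M x0 w k i) (w (Suc k) i))
      in (\<lambda>i. analysis_map H R T (Y (Suc k)) (ens_mean M xf) (ens_cov M xf) (xf i)))"

text \<open>Meaningful for \<open>k \<ge> 1\<close> only; likewise for \<open>mean_field_f\<close> below.\<close>

definition esrf_f ::
    "(real ^ 'd \<Rightarrow> real ^ 'd) \<Rightarrow> real ^ 'r ^ 'd \<Rightarrow> real ^ 'd ^ 'q \<Rightarrow> real ^ 'q ^ 'q
      \<Rightarrow> (real ^ 'd ^ 'd \<Rightarrow> real ^ 'd ^ 'd) \<Rightarrow> (nat \<Rightarrow> real ^ 'q) \<Rightarrow> nat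
      \<Rightarrow> (nat \<Rightarrow> real ^ 'd) \<Rightarrow> (nat \<Rightarrow> nat \<Rightarrow> real ^ 'r) \<Rightarrow> nat \<Rightarrow> nat \<Rightarrow> real ^ 'd" where
  "esrf_f B C H R T Y M x0 w k i =
     forecast_map B C (esrf_a B C H R T Y M x0 w (k - 1) i) (w k i)"

definition law_mean :: "'w measure \<Rightarrow> ('w \<Rightarrow> real ^ 'd) \<Rightarrow> real ^ 'd" where
  "law_mean \<P> X = (\<integral>\<omega>. X \<omega> \<partial>\<P>)"

definition law_cov :: "'w measure \<Rightarrow> ('w \<Rightarrow> real ^ 'd) \<Rightarrow> real ^ 'd ^ 'd" where
  "law_cov \<P> X = (\<integral>\<omega>. outer (X \<omega> - law_mean \<P> X) (X \<omega> - law_mean \<P> X) \<partial>\<P>)"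

text \<open>
  The mean-field process driven by the initial condition \<open>X0\<close> and the noise \<open>W k\<close>, which are
  random variables here because the recursion involves the law of the process.
\<close>

primrec mean_field_a ::
    "'w measure \<Rightarrow> (real ^ 'd \<Rightarrow> real ^ 'd) \<Rightarrow> real ^ 'r ^ 'd \<Rightarrow> real ^ 'd ^ 'q \<Rightarrow> real ^ 'q ^ 'q
      \<Rightarrow> (real ^ 'd ^ 'd \<Rightarrow> real ^ 'd ^ 'd) \<Rightarrow> (nat \<Rightarrow> real ^ 'q)
      \<Rightarrow> ('w \<Rightarrow> real ^ 'd) \<Rightarrow> (nat \<Rightarrow> 'w \<Rightarrow> real ^ 'r) \<Rightarrow> nat \<Rightarrow> 'w \<Rightarrow> real ^ 'd" where
  "mean_field_a \<P> B C H R T Y X0 W 0 = X0"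
| "mean_field_a \<P> B C H R T Y X0 W (Suc k) =
     (let Xf = (\<lambda>\<omega>. forecast_map B C (mean_field_a \<P> B C H R T Y X0 W k \<omega>) (W (Suc k) \<omega>))
      in (\<lambda>\<omega>. analysis_map H R T (Y (Suc k)) (law_mean \<P> Xf) (law_cov \<P> Xf) (Xf \<omega>)))"

definition mean_field_f ::
    "'w measure \<Rightarrow> (real ^ 'd \<Rightarrow> real ^ 'd) \<Rightarrow> real ^ 'r ^ 'd \<Rightarrow> real ^ 'd ^ 'q \<Rightarrow> real ^ 'q ^ 'q
      \<Rightarrow> (real ^ 'd ^ 'd \<Rightarrow> real ^ 'd ^ 'd) \<Rightarrow> (nat \<Rightarrow> real ^ 'q)
      \<Rightarrow> ('w \<Rightarrow> real ^ 'd) \<Rightarrow> (nat \<Rightarrow> 'w \<Rightarrow> real ^ 'r) \<Rightarrow> nat \<Rightarrow> 'w \<Rightarrow> real ^ 'd" where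
  "mean_field_f \<P> B C H R T Y X0 W k \<omega> =
     forecast_map B C (mean_field_a \<P> B C H R T Y X0 W (k - 1) \<omega>) (W k \<omega>)"

text \<open>
  The expectation is taken in \<^typ>\<open>ennreal\<close>, so that finiteness of the error is part of any bound
  on it: the Bochner integral of a non-integrable function is 0.
\<close>

definition ennreal_root :: "real \<Rightarrow> ennreal \<Rightarrow> ennreal" where
  "ennreal_root p x = (if x = \<infinity> then \<infinity> else ennreal (enn2real x powr (1 / p)))"

definition ensemble_error ::
    "'w measure \<Rightarrow> nat \<Rightarrow> real \<Rightarrow> (nat \<Rightarrow> 'w \<Rightarrow> real ^ 'd) \<Rightarrow> (nat \<Rightarrow> 'w \<Rightarrow> real ^ 'd) \<Rightarrow> ennreal" where
  "ensemble_error \<P> M p X Z =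
     ennreal_root p
       (\<integral>\<^sup>+ \<omega>. ennreal (1 / real M * (\<Sum>i=1..M. norm (X i \<omega> - Z i \<omega>) powr p)) \<partial>\<P>)"

end

theory Submission
  imports Defs
begin

text \<open>
  The filter is compared with the mean-field copies along the same noise. The analysis map is
  Lipschitz in the forecast, the mean and the covariance, with constants that are polynomial in the
  deviations \<open>d\<close> and \<open>\<delta>\<close> of the empirical mean and covariance from those of the mean-field law. These
  deviations are controlled by the forecast errors of the particles and by the law of large numbers
  for the i.i.d. copies, whose moments are of order \<open>1 / sqrt M\<close>. Hence all moments of
  \<open>sqrt M * |X - Z|\<close> stay bounded, uniformly in \<open>M\<close> and in the particle, from one step to the next;
  products cost only higher moments.
\<close>

subsection \<open>Families with uniformly bounded moments\<close>

text \<open>No single exponent p closes under the recursion: the Lipschitz constant of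
  \<open>T\<close> grows quadratically in the covariance, and the empirical covariance is itself
  quadratic in the particles. Errors at one time are therefore bounded by products of errors and
  fluctuations, and the induction hypothesis must speak of all moments at once; p reappears only
  when the root error is formed. Three choices keep the estimates short. The analysis map is
  compared with its value at the deterministic mean-field pair (m, P), so constants may depend on P
  and only the deviation P' - P is random. In every product a single factor has to carry sqrt M; the
  others need mere boundedness, which follows from sqrt M >= 1. The law of large numbers is applied
  to the copies only, never to the particles, which interact. That the copies are i.i.d. needs an
  argument of its own, because each of them is defined through the laws of its own
  forecasts.\<close>

text \<open>
  The dominating measurable variables \<open>V\<close> make measurability of \<open>U\<close> itself unnecessary. This matters
  because the transformation \<open>T\<close> is arbitrary outside the positive semidefinite matrices, and because
  the nonnegative integral is not subadditive on nonmeasurable functions.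
\<close>

definition moment_bounded :: "'w measure \<Rightarrow> 'i set \<Rightarrow> ('i \<Rightarrow> 'w \<Rightarrow> real) \<Rightarrow> bool" where
  "moment_bounded \<P> I U \<longleftrightarrow>
     (\<exists>V. (\<forall>i\<in>I. V i \<in> borel_measurable \<P> \<and> (\<forall>\<omega>\<in>space \<P>. \<bar>U i \<omega>\<bar> \<le> V i \<omega>)) \<and>
          (\<forall>n::nat. \<exists>c::real. \<forall>i\<in>I. (\<integral>\<^sup>+\<omega>. ennreal (V i \<omega> ^ n) \<partial>\<P>) \<le> ennreal c))"

lemma moment_boundedI:
  assumes "\<And>i. i \<in> I \<Longrightarrow> V i \<in> borel_measurable \<P>"
    and "\<And>i \<omega>. i \<in> I \<Longrightarrow> \<omega> \<in> space \<P> \<Longrightarrow> \<bar>U i \<omega>\<bar> \<le> V i \<omega>"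
    and "\<And>n::nat. \<exists>c::real. \<forall>i\<in>I. (\<integral>\<^sup>+\<omega>. ennreal (V i \<omega> ^ n) \<partial>\<P>) \<le> ennreal c"
  shows "moment_bounded \<P> I U"
  unfolding moment_bounded_def using assms by blast

lemma moment_boundedE:
  assumes "moment_bounded \<P> I U"
  obtains V where "\<And>i. i \<in> I \<Longrightarrow> V i \<in> borel_measurable \<P>"
    and "\<And>i \<omega>. i \<in> I \<Longrightarrow> \<omega> \<in> space \<P> \<Longrightarrow> \<bar>U i \<omega>\<bar> \<le> V i \<omega>"
    and "\<And>i \<omega>. i \<in> I \<Longrightarrow> \<omega> \<in> space \<P> \<Longrightarrow> 0 \<le> V i \<omega>"
    and "\<And>n::nat. \<exists>c\<ge>0. \<forall>i\<in>I. (\<integral>\<^sup>+\<omega>. ennreal (V i \<omega> ^ n) \<partial>\<P>) \<le> ennreal c"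
proof -
  obtain V where V: "\<And>i. i \<in> I \<Longrightarrow> V i \<in> borel_measurable \<P>"
    "\<And>i \<omega>. i \<in> I \<Longrightarrow> \<omega> \<in> space \<P> \<Longrightarrow> \<bar>U i \<omega>\<bar> \<le> V i \<omega>"
    "\<And>n::nat. \<exists>c::real. \<forall>i\<in>I. (\<integral>\<^sup>+\<omega>. ennreal (V i \<omega> ^ n) \<partial>\<P>) \<le> ennreal c"
    using assms unfolding moment_bounded_def by blast
  have "\<exists>c\<ge>0. \<forall>i\<in>I. (\<integral>\<^sup>+\<omega>. ennreal (V i \<omega> ^ n) \<partial>\<P>) \<le> ennreal c" for n
  proof -
    obtain c where "\<forall>i\<in>I. (\<integral>\<^sup>+\<omega>. ennreal (V i \<omega> ^ n) \<partial>\<P>) \<le> ennreal c" using V(3) by blast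
    moreover have "ennreal c \<le> ennreal (max 0 c)" by (simp add: ennreal_leI)
    ultimately have "\<forall>i\<in>I. (\<integral>\<^sup>+\<omega>. ennreal (V i \<omega> ^ n) \<partial>\<P>) \<le> ennreal (max 0 c)"
      by (metis order_trans)
    then show ?thesis by (intro exI[of _ "max 0 c"]) simp
  qed
  moreover have "0 \<le> V i \<omega>" if "i \<in> I" "\<omega> \<in> space \<P>" for i \<omega>
    using V(2)[OF that] by linarith
  ultimately show thesis using that V by blast
qed

lemma moment_bounded_mono:
  assumes "moment_bounded \<P> I U" "\<And>i \<omega>. i \<in> I \<Longrightarrow> \<omega> \<in> space \<P> \<Longrightarrow> \<bar>U' i \<omega>\<bar> \<le> U i \<omega>"
  shows "moment_bounded \<P> I U'"
proof -
  obtain V where V: "\<And>i. i \<in> I \<Longrightarrow> V i \<in> borel_measurable \<P>"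
    "\<And>i \<omega>. i \<in> I \<Longrightarrow> \<omega> \<in> space \<P> \<Longrightarrow> \<bar>U i \<omega>\<bar> \<le> V i \<omega>"
    "\<And>n::nat. \<exists>c\<ge>0. \<forall>i\<in>I. (\<integral>\<^sup>+\<omega>. ennreal (V i \<omega> ^ n) \<partial>\<P>) \<le> ennreal c"
    using assms(1) by (rule moment_boundedE) blast
  show ?thesis
    by (rule moment_boundedI[where V = V]) (use V assms(2) in \<open>force+\<close>)
qed

lemma moment_bounded_abs:
  assumes "moment_bounded \<P> I U"
  shows "moment_bounded \<P> I (\<lambda>i \<omega>. \<bar>U i \<omega>\<bar>)"
  using assms by (simp add: moment_bounded_def)

lemma moment_bounded_reindex:
  assumes "moment_bounded \<P> I U" "\<And>j. j \<in> J \<Longrightarrow> f j \<in> I"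
  shows "moment_bounded \<P> J (\<lambda>j. U (f j))"
proof -
  obtain V where V: "\<And>i. i \<in> I \<Longrightarrow> V i \<in> borel_measurable \<P>"
    "\<And>i \<omega>. i \<in> I \<Longrightarrow> \<omega> \<in> space \<P> \<Longrightarrow> \<bar>U i \<omega>\<bar> \<le> V i \<omega>"
    "\<And>n::nat. \<exists>c\<ge>0. \<forall>i\<in>I. (\<integral>\<^sup>+\<omega>. ennreal (V i \<omega> ^ n) \<partial>\<P>) \<le> ennreal c"
    using assms(1) by (rule moment_boundedE) blast
  show ?thesis
    by (rule moment_boundedI[where V = "\<lambda>j. V (f j)"]) (use V assms(2) in \<open>force+\<close>)
qed

text \<open>Common core of the closure under sums and products. The bound \<open>poly\<close>
  separates the two variables, so moments of the combination are controlled by marginal moments of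
  the dominating variables, whatever their dependence. \<open>F\<close> acts on the dominating
  variables, hence measurability is asked of \<open>F\<close> and not of \<open>G\<close>.\<close>

lemma moment_bounded_combine:
  fixes a b :: "nat \<Rightarrow> nat" and \<alpha> \<beta> :: "nat \<Rightarrow> real"
  assumes "moment_bounded \<P> I U" "moment_bounded \<P> I U'"
    and F: "F \<in> borel_measurable (borel \<Otimes>\<^sub>M borel)"
    and dom: "\<And>x y u v. \<bar>x\<bar> \<le> u \<Longrightarrow> \<bar>y\<bar> \<le> v \<Longrightarrow> \<bar>G x y\<bar> \<le> F (u, v)"
    and pos: "\<And>n. 0 \<le> \<alpha> n" "\<And>n. 0 \<le> \<beta> n"
    and poly: "\<And>n x y. 0 \<le> x \<Longrightarrow> 0 \<le> y \<Longrightarrow> F (x, y) ^ n \<le> \<alpha> n * x ^ a n + \<beta> n * y ^ b n"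
  shows "moment_bounded \<P> I (\<lambda>i \<omega>. G (U i \<omega>) (U' i \<omega>))"
proof -
  obtain V where V: "\<And>i. i \<in> I \<Longrightarrow> V i \<in> borel_measurable \<P>"
    "\<And>i \<omega>. i \<in> I \<Longrightarrow> \<omega> \<in> space \<P> \<Longrightarrow> \<bar>U i \<omega>\<bar> \<le> V i \<omega>"
    "\<And>i \<omega>. i \<in> I \<Longrightarrow> \<omega> \<in> space \<P> \<Longrightarrow> 0 \<le> V i \<omega>"
    "\<And>n::nat. \<exists>c\<ge>0. \<forall>i\<in>I. (\<integral>\<^sup>+\<omega>. ennreal (V i \<omega> ^ n) \<partial>\<P>) \<le> ennreal c"
    using assms(1) by (rule moment_boundedE) blast
  obtain V' where V': "\<And>i. i \<in> I \<Longrightarrow> V' i \<in> borel_measurable \<P>"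
    "\<And>i \<omega>. i \<in> I \<Longrightarrow> \<omega> \<in> space \<P> \<Longrightarrow> \<bar>U' i \<omega>\<bar> \<le> V' i \<omega>"
    "\<And>i \<omega>. i \<in> I \<Longrightarrow> \<omega> \<in> space \<P> \<Longrightarrow> 0 \<le> V' i \<omega>"
    "\<And>n::nat. \<exists>c\<ge>0. \<forall>i\<in>I. (\<integral>\<^sup>+\<omega>. ennreal (V' i \<omega> ^ n) \<partial>\<P>) \<le> ennreal c"
    using assms(2) by (rule moment_boundedE) blast
  show ?thesis
  proof (rule moment_boundedI[where V = "\<lambda>i \<omega>. F (V i \<omega>, V' i \<omega>)"])
    fix i assume i: "i \<in> I"
    note [measurable] = V(1)[OF i] V'(1)[OF i] F
    show "(\<lambda>\<omega>. F (V i \<omega>, V' i \<omega>)) \<in> borel_measurable \<P>" by measurable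
    show "\<bar>G (U i \<omega>) (U' i \<omega>)\<bar> \<le> F (V i \<omega>, V' i \<omega>)" if "\<omega> \<in> space \<P>" for \<omega>
      using dom V(2) V'(2) i that by blast
  next
    fix n :: nat
    obtain c where c: "c \<ge> 0" "\<And>i. i\<in>I \<Longrightarrow> (\<integral>\<^sup>+\<omega>. ennreal (V i \<omega> ^ a n) \<partial>\<P>) \<le> ennreal c"
      using V(4) by blast
    obtain c' where c': "c' \<ge> 0" "\<And>i. i\<in>I \<Longrightarrow> (\<integral>\<^sup>+\<omega>. ennreal (V' i \<omega> ^ b n) \<partial>\<P>) \<le> ennreal c'"
      using V'(4) by blast
    have "(\<integral>\<^sup>+\<omega>. ennreal (F (V i \<omega>, V' i \<omega>) ^ n) \<partial>\<P>) \<le> ennreal (\<alpha> n * c + \<beta> n * c')"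
      if i: "i \<in> I" for i
    proof -
      note [measurable] = V(1)[OF i] V'(1)[OF i]
      have "(\<integral>\<^sup>+\<omega>. ennreal (F (V i \<omega>, V' i \<omega>) ^ n) \<partial>\<P>)
          \<le> (\<integral>\<^sup>+\<omega>. ennreal (\<alpha> n) * ennreal (V i \<omega> ^ a n) + ennreal (\<beta> n) * ennreal (V' i \<omega> ^ b n) \<partial>\<P>)"
        using pos poly V(3)[OF i] V'(3)[OF i]
        by (intro nn_integral_mono)
           (simp add: ennreal_mult[symmetric] ennreal_plus[symmetric] ennreal_leI del: ennreal_plus)
      also have "\<dots> = ennreal (\<alpha> n) * (\<integral>\<^sup>+\<omega>. ennreal (V i \<omega> ^ a n) \<partial>\<P>)
          + ennreal (\<beta> n) * (\<integral>\<^sup>+\<omega>. ennreal (V' i \<omega> ^ b n) \<partial>\<P>)"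
        by (simp add: nn_integral_add nn_integral_cmult)
      also have "\<dots> \<le> ennreal (\<alpha> n) * ennreal c + ennreal (\<beta> n) * ennreal c'"
        by (intro add_mono mult_left_mono c(2) c'(2) i) auto
      also have "\<dots> = ennreal (\<alpha> n * c + \<beta> n * c')"
        using pos c(1) c'(1) by (simp add: ennreal_mult ennreal_plus)
      finally show ?thesis .
    qed
    then show "\<exists>c. \<forall>i\<in>I. (\<integral>\<^sup>+\<omega>. ennreal (F (V i \<omega>, V' i \<omega>) ^ n) \<partial>\<P>) \<le> ennreal c"
      by blast
  qed
qed

text \<open>Rests on x + y <= 2 max(x, y): the n-th power of the maximum is one of the two powers,
  and the other is nonnegative.\<close>

lemma moment_bounded_add:
  assumes "moment_bounded \<P> I U" "moment_bounded \<P> I U'"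
  shows "moment_bounded \<P> I (\<lambda>i \<omega>. U i \<omega> + U' i \<omega>)"
proof (rule moment_bounded_combine[OF assms, where F = "\<lambda>(u, v). u + v"
      and \<alpha> = "\<lambda>n. 2 ^ n" and \<beta> = "\<lambda>n. 2 ^ n" and a = "\<lambda>n. n" and b = "\<lambda>n. n"])
  fix n :: nat and x y :: real
  assume "0 \<le> x" "0 \<le> y"
  then have "(x + y) ^ n \<le> (2 * max x y) ^ n" by (intro power_mono) auto
  also have "\<dots> \<le> (2 * x) ^ n + (2 * y) ^ n"
    using \<open>0 \<le> x\<close> \<open>0 \<le> y\<close> by (simp add: max_def)
  finally show "(case (x, y) of (u, v) \<Rightarrow> u + v) ^ n \<le> 2 ^ n * x ^ n + 2 ^ n * y ^ n"
    by (simp add: power_mult_distrib)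
qed auto

text \<open>Young's inequality: the n-th moment of the product costs the moments of order 2n of the
  factors.\<close>

lemma moment_bounded_mult:
  assumes "moment_bounded \<P> I U" "moment_bounded \<P> I U'"
  shows "moment_bounded \<P> I (\<lambda>i \<omega>. U i \<omega> * U' i \<omega>)"
proof (rule moment_bounded_combine[OF assms, where F = "\<lambda>(u, v). u * v"
      and \<alpha> = "\<lambda>n. 1" and \<beta> = "\<lambda>n. 1" and a = "\<lambda>n. n * 2" and b = "\<lambda>n. n * 2"])
  fix n :: nat and x y :: real
  assume "0 \<le> x" "0 \<le> y"
  then have "0 \<le> x ^ n * y ^ n" by simp
  moreover have "2 * (x ^ n * y ^ n) \<le> (x ^ n)\<^sup>2 + (y ^ n)\<^sup>2"
    using sum_squares_bound[of "x ^ n" "y ^ n"] by simp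
  ultimately show "(case (x, y) of (u, v) \<Rightarrow> u * v) ^ n \<le> 1 * x ^ (n * 2) + 1 * y ^ (n * 2)"
    by (simp add: power_mult_distrib power_mult)
qed (auto simp: abs_mult intro!: mult_mono)

context prob_space
begin

lemma moment_bounded_const: "moment_bounded M I (\<lambda>i \<omega>. c)"
  by (rule moment_boundedI[where V = "\<lambda>i \<omega>. \<bar>c\<bar>"]) (auto simp: emeasure_space_1)

lemma moment_bounded_power:
  assumes "moment_bounded M I U"
  shows "moment_bounded M I (\<lambda>i \<omega>. U i \<omega> ^ n)"
  by (induction n) (simp_all add: moment_bounded_const moment_bounded_mult assms)

lemma moment_bounded_cmult:
  assumes "moment_bounded M I U"
  shows "moment_bounded M I (\<lambda>i \<omega>. c * U i \<omega>)"
  by (intro moment_bounded_mult moment_bounded_const assms)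

lemma moment_bounded_sum:
  assumes "\<And>b. b \<in> S \<Longrightarrow> moment_bounded M I (U b)"
  shows "moment_bounded M I (\<lambda>i \<omega>. \<Sum>b\<in>S. U b i \<omega>)"
  using assms
  by (induction S rule: infinite_finite_induct)
     (simp_all add: moment_bounded_const moment_bounded_add)

text \<open>The way back from dominating variables to Bochner integrals, where \<open>U\<close>
  itself has to be measurable. One constant serves the whole family.\<close>

lemma moment_bounded_moments:
  assumes U: "moment_bounded M I U" and meas: "\<And>i. i \<in> I \<Longrightarrow> U i \<in> borel_measurable M"
  obtains c where "c \<ge> 0" "\<And>i. i \<in> I \<Longrightarrow> integrable M (\<lambda>\<omega>. \<bar>U i \<omega>\<bar> ^ n)"
    "\<And>i. i \<in> I \<Longrightarrow> (\<integral>\<omega>. \<bar>U i \<omega>\<bar> ^ n \<partial>M) \<le> c"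
proof -
  obtain V where V: "\<And>i. i \<in> I \<Longrightarrow> V i \<in> borel_measurable M"
    "\<And>i \<omega>. i \<in> I \<Longrightarrow> \<omega> \<in> space M \<Longrightarrow> \<bar>U i \<omega>\<bar> \<le> V i \<omega>"
    "\<And>n::nat. \<exists>c\<ge>0. \<forall>i\<in>I. (\<integral>\<^sup>+\<omega>. ennreal (V i \<omega> ^ n) \<partial>M) \<le> ennreal c"
    using U by (rule moment_boundedE) blast
  obtain c where c: "c \<ge> 0" "\<And>i. i\<in>I \<Longrightarrow> (\<integral>\<^sup>+\<omega>. ennreal (V i \<omega> ^ n) \<partial>M) \<le> ennreal c"
    using V(3) by blast
  have *: "(\<integral>\<^sup>+\<omega>. ennreal (\<bar>U i \<omega>\<bar> ^ n) \<partial>M) \<le> ennreal c" if "i \<in> I" for i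
    by (rule order_trans[OF _ c(2)[OF that]])
       (intro nn_integral_mono ennreal_leI power_mono V(2) that, auto)
  have int: "integrable M (\<lambda>\<omega>. \<bar>U i \<omega>\<bar> ^ n)" if i: "i \<in> I" for i
  proof (rule integrableI_nonneg)
    show "(\<lambda>\<omega>. \<bar>U i \<omega>\<bar> ^ n) \<in> borel_measurable M" using meas[OF i] by measurable
    show "(\<integral>\<^sup>+\<omega>. ennreal (\<bar>U i \<omega>\<bar> ^ n) \<partial>M) < \<infinity>"
      using *[OF i] by (simp add: order_le_less_trans)
  qed auto
  have "(\<integral>\<omega>. \<bar>U i \<omega>\<bar> ^ n \<partial>M) \<le> c" if "i \<in> I" for i
    using *[OF that] c(1) nn_integral_eq_integral[OF int[OF that]] by simp
  then show thesis using that c(1) int by blast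
qed

lemma moment_bounded_integrable:
  assumes "moment_bounded M I U" "i \<in> I" "U i \<in> borel_measurable M"
  shows "integrable M (U i)"
proof -
  have "moment_bounded M {i} U"
    using moment_bounded_reindex[OF assms(1), of "{i}" "\<lambda>j. j"] assms(2) by simp
  then obtain c :: real where "integrable M (\<lambda>\<omega>. \<bar>U i \<omega>\<bar> ^ 1)"
    using moment_bounded_moments[of "{i}" U 1] assms(3) by auto
  then show ?thesis using integrable_abs_cancel[OF _ assms(3)] by simp
qed

end

section \<open>Averages over the particles of an ensemble\<close>

lemma power_mean_le:
  fixes v :: "'i \<Rightarrow> real"
  assumes "finite S" "S \<noteq> {}" "\<And>i. i \<in> S \<Longrightarrow> 0 \<le> v i"
  shows "((\<Sum>i\<in>S. v i) / card S) ^ n \<le> (\<Sum>i\<in>S. v i ^ n) / card S"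
proof -
  \<comment> \<open>Even powers are convex on the whole line, odd ones on the half-line; Jensen's
    inequality with equal weights follows.\<close>
  have conv: "convex_on {0::real..} (\<lambda>x. x ^ n)"
    by (cases "even n") (auto intro: convex_power_odd convex_on_subset[OF convex_power_even])
  have "(\<Sum>i\<in>S. (1 / card S) *\<^sub>R v i) ^ n \<le> (\<Sum>i\<in>S. (1 / card S) * v i ^ n)"
    using assms conv by (intro convex_on_sum[where C = "{0..}"]) auto
  then show ?thesis by (simp add: sum_divide_distrib)
qed

text \<open>Indexing by the pair of ensemble size and particle number makes one
  \<open>moment_bounded\<close> statement uniform in both.\<close>

definition particles :: "(nat \<times> nat) set" where
  "particles = {(M, i). 2 \<le> M \<and> i \<in> {1..M}}"

text \<open>By Jensen's inequality the n-th moment of an average is at most the average of the n-th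
  moments, so the bound for single particles survives with the same constant. Independence does not
  enter, hence this applies to the interacting particles.\<close>

lemma moment_bounded_average:
  assumes "moment_bounded \<P> particles (\<lambda>j. U (fst j) (snd j))"
  shows "moment_bounded \<P> {2..} (\<lambda>M \<omega>. (\<Sum>i=1..M. U M i \<omega>) / M)"
proof -
  obtain V where V: "\<And>j. j \<in> particles \<Longrightarrow> V j \<in> borel_measurable \<P>"
    "\<And>j \<omega>. j \<in> particles \<Longrightarrow> \<omega> \<in> space \<P> \<Longrightarrow> \<bar>U (fst j) (snd j) \<omega>\<bar> \<le> V j \<omega>"
    "\<And>j \<omega>. j \<in> particles \<Longrightarrow> \<omega> \<in> space \<P> \<Longrightarrow> 0 \<le> V j \<omega>"
    "\<And>n::nat. \<exists>c\<ge>0. \<forall>j\<in>particles. (\<integral>\<^sup>+\<omega>. ennreal (V j \<omega> ^ n) \<partial>\<P>) \<le> ennreal c"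
    using assms(1) by (rule moment_boundedE) blast
  show ?thesis
  proof (rule moment_boundedI[where V = "\<lambda>M \<omega>. (\<Sum>i=1..M. V (M, i) \<omega>) / M"])
    fix M :: nat assume M: "M \<in> {2..}"
    have [measurable]: "V (M, i) \<in> borel_measurable \<P>" if "i \<in> {1..M}" for i
      using V(1) M that by (auto simp: particles_def)
    show "(\<lambda>\<omega>. (\<Sum>i=1..M. V (M, i) \<omega>) / M) \<in> borel_measurable \<P>" by measurable
    fix \<omega> assume \<omega>: "\<omega> \<in> space \<P>"
    have "\<bar>U M i \<omega>\<bar> \<le> V (M, i) \<omega>" if "i \<in> {1..M}" for i
      using V(2)[of "(M, i)" \<omega>] M that \<omega> by (auto simp: particles_def)
    then have "\<bar>\<Sum>i=1..M. U M i \<omega>\<bar> \<le> (\<Sum>i=1..M. V (M, i) \<omega>)"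
      by (intro order_trans[OF sum_abs] sum_mono) auto
    then show "\<bar>(\<Sum>i=1..M. U M i \<omega>) / M\<bar> \<le> (\<Sum>i=1..M. V (M, i) \<omega>) / M"
      by (simp add: divide_right_mono)
  next
    fix n :: nat
    obtain c where c: "c \<ge> 0" "\<And>j. j\<in>particles \<Longrightarrow> (\<integral>\<^sup>+\<omega>. ennreal (V j \<omega> ^ n) \<partial>\<P>) \<le> ennreal c"
      using V(4) by blast
    have "(\<integral>\<^sup>+\<omega>. ennreal (((\<Sum>i=1..M. V (M, i) \<omega>) / M) ^ n) \<partial>\<P>) \<le> ennreal c"
      if M: "M \<in> {2..}" for M :: nat
    proof -
      have j: "(M, i) \<in> particles" if "i \<in> {1..M}" for i using M that by (auto simp: particles_def)
      note [measurable] = V(1)[OF j]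
      have "(\<integral>\<^sup>+\<omega>. ennreal (((\<Sum>i=1..M. V (M, i) \<omega>) / M) ^ n) \<partial>\<P>)
          \<le> (\<integral>\<^sup>+\<omega>. (\<Sum>i=1..M. ennreal (V (M, i) \<omega> ^ n)) * ennreal (1 / M) \<partial>\<P>)"
      proof (intro nn_integral_mono)
        fix \<omega> assume \<omega>: "\<omega> \<in> space \<P>"
        have "((\<Sum>i=1..M. V (M, i) \<omega>) / M) ^ n \<le> (\<Sum>i=1..M. V (M, i) \<omega> ^ n) / M"
          using power_mean_le[of "{1..M}" "\<lambda>i. V (M, i) \<omega>" n] M V(3)[OF j \<omega>] by simp
        also have "\<dots> = (\<Sum>i=1..M. V (M, i) \<omega> ^ n) * (1 / M)" by simp
        finally have "ennreal (((\<Sum>i=1..M. V (M, i) \<omega>) / M) ^ n)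
            \<le> ennreal ((\<Sum>i=1..M. V (M, i) \<omega> ^ n) * (1 / M))" by (rule ennreal_leI)
        also have "\<dots> = (\<Sum>i=1..M. ennreal (V (M, i) \<omega> ^ n)) * ennreal (1 / M)"
        proof -
          have nonneg: "0 \<le> V (M, i) \<omega> ^ n" if "i \<in> {1..M}" for i using V(3)[OF j \<omega>] that by simp
          show ?thesis
            using sum_ennreal[of "{1..M}" "\<lambda>i. V (M, i) \<omega> ^ n"] nonneg
              ennreal_mult[OF sum_nonneg[of "{1..M}" "\<lambda>i. V (M, i) \<omega> ^ n"], of "1 / M"] by simp
        qed
        finally show "ennreal (((\<Sum>i=1..M. V (M, i) \<omega>) / M) ^ n)
            \<le> (\<Sum>i=1..M. ennreal (V (M, i) \<omega> ^ n)) * ennreal (1 / M)" .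
      qed
      also have "\<dots> = (\<Sum>i=1..M. (\<integral>\<^sup>+\<omega>. ennreal (V (M, i) \<omega> ^ n) \<partial>\<P>)) * ennreal (1 / M)"
      proof (subst nn_integral_multc)
        have meas: "(\<lambda>\<omega>. ennreal (V (M, i) \<omega> ^ n)) \<in> borel_measurable \<P>" if "i \<in> {1..M}" for i
          using V(1)[OF j[OF that]] by measurable
        show "(\<lambda>\<omega>. \<Sum>i=1..M. ennreal (V (M, i) \<omega> ^ n)) \<in> borel_measurable \<P>"
          using meas by measurable
        show "(\<integral>\<^sup>+\<omega>. (\<Sum>i=1..M. ennreal (V (M, i) \<omega> ^ n)) \<partial>\<P>) * ennreal (1 / M)
          = (\<Sum>i=1..M. (\<integral>\<^sup>+\<omega>. ennreal (V (M, i) \<omega> ^ n) \<partial>\<P>)) * ennreal (1 / M)"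
          using meas by (subst nn_integral_sum) auto
      qed
      also have "\<dots> \<le> (\<Sum>i=1..M. ennreal c) * ennreal (1 / M)"
        by (intro mult_right_mono sum_mono c(2) j) auto
      also have "\<dots> = ennreal c"
        using M c(1)
        by (subst sum_ennreal) (auto simp: ennreal_mult[symmetric])
      finally show ?thesis .
    qed
    then show "\<exists>c. \<forall>M\<in>{2..}. (\<integral>\<^sup>+\<omega>. ennreal (((\<Sum>i=1..M. V (M, i) \<omega>) / M) ^ n) \<partial>\<P>) \<le> ennreal c"
      by blast
  qed
qed

subsection \<open>Moments of centered averages\<close>

text \<open>Stands in for Lyapunov's inequality: a lower moment is dominated by a higher one at the
  price of an additive 1, without fractional exponents.\<close>

lemma power_le_one_plus_power:
  fixes x :: real
  assumes "0 \<le> x" "m \<le> n"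
  shows "x ^ m \<le> 1 + x ^ n"
proof (cases "x \<le> 1")
  case True
  then have "x ^ m \<le> 1" using assms(1) by (simp add: power_le_one)
  moreover have "0 \<le> x ^ n" using assms(1) by simp
  ultimately show ?thesis by linarith
next
  case False
  then have "x ^ m \<le> x ^ n" using assms(2) by (intro power_increasing) auto
  then show ?thesis by linarith
qed

context prob_space
begin

text \<open>A Marcinkiewicz-Zygmund type bound by induction on n. Expanding the power q = 2n + 2 of
  S + X, the term linear in X vanishes by independence and centering; all later terms contain
  moments of S of order at most 2n, which are O(N^n) by the induction hypothesis. One more summand
  thus adds O(N^n), and N summands give O(N^(n+1)).\<close>

lemma centered_sum_even_moment:
  fixes X :: "nat \<Rightarrow> 'a \<Rightarrow> real"
  assumes indep: "indep_vars (\<lambda>_. borel) X {1..}"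
    and mb: "moment_bounded M {1..} X"
    and centered: "\<And>i. i \<ge> 1 \<Longrightarrow> expectation (X i) = 0"
  defines "S \<equiv> \<lambda>N \<omega>. \<Sum>i=1..N. X i \<omega>"
  shows "(\<forall>N k. integrable M (\<lambda>\<omega>. S N \<omega> ^ k)) \<and>
    (\<exists>c\<ge>0. \<forall>N. expectation (\<lambda>\<omega>. S N \<omega> ^ (2 * n)) \<le> c * real N ^ n)"
proof -
  have [measurable]: "X i \<in> borel_measurable M" if "i \<ge> 1" for i
    using indep that by (auto simp: indep_vars_def)
  have measS[measurable]: "S N \<in> borel_measurable M" for N unfolding S_def by measurable
  have intS: "integrable M (\<lambda>\<omega>. S N \<omega> ^ k)" for N k
  proof -
    \<comment> \<open>A single variable is a family over the one-point index set. Uniformity in N is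
      not claimed here; only integrability of the powers is extracted.\<close>
    have "moment_bounded M {()} (\<lambda>_. X i)" if "i \<in> {1..N}" for i
      using moment_bounded_reindex[OF mb, of "{()}" "\<lambda>_. i"] that by simp
    then have "moment_bounded M {()} (\<lambda>_ \<omega>. S N \<omega> ^ k)"
      unfolding S_def by (intro moment_bounded_power moment_bounded_sum)
    from moment_bounded_integrable[OF this, of "()"] show ?thesis by simp
  qed
  have intX: "integrable M (\<lambda>\<omega>. X i \<omega> ^ k)" if "i \<ge> 1" for i k
    using moment_bounded_integrable[OF moment_bounded_power[OF mb], of i k] that by simp
  have "\<exists>m\<ge>0. \<forall>i\<ge>1. expectation (\<lambda>\<omega>. \<bar>X i \<omega>\<bar> ^ k) \<le> m" for k
    using moment_bounded_moments[OF mb, of k] by (metis atLeast_iff indep indep_vars_def)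
  then obtain m where m: "\<And>k. 0 \<le> m k" "\<And>k i. i \<ge> 1 \<Longrightarrow> expectation (\<lambda>\<omega>. \<bar>X i \<omega>\<bar> ^ k) \<le> m k"
    by metis
  have indS: "indep_var borel (X (Suc N)) borel (S N)" for N
  proof -
    have "insert (Suc N) {1..N} \<subseteq> {1..}" by auto
    from indep_vars_sum[OF _ _ indep_vars_subset[OF indep this]] show ?thesis
      unfolding S_def by simp
  qed
  have prodE: "expectation (\<lambda>\<omega>. X (Suc N) \<omega> ^ j * S N \<omega> ^ k)
      = expectation (\<lambda>\<omega>. X (Suc N) \<omega> ^ j) * expectation (\<lambda>\<omega>. S N \<omega> ^ k)"
    and prodI: "integrable M (\<lambda>\<omega>. X (Suc N) \<omega> ^ j * S N \<omega> ^ k)" for N j k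
  proof -
    have "indep_var borel ((\<lambda>x. x ^ j) \<circ> X (Suc N)) borel ((\<lambda>x. x ^ k) \<circ> S N)"
      by (rule indep_var_compose[OF indS]) measurable
    then have ind: "indep_var borel (\<lambda>\<omega>. X (Suc N) \<omega> ^ j) borel (\<lambda>\<omega>. S N \<omega> ^ k)"
      by (simp add: o_def)
    show "expectation (\<lambda>\<omega>. X (Suc N) \<omega> ^ j * S N \<omega> ^ k)
      = expectation (\<lambda>\<omega>. X (Suc N) \<omega> ^ j) * expectation (\<lambda>\<omega>. S N \<omega> ^ k)"
      by (rule indep_var_lebesgue_integral[OF ind]) (auto intro: intX intS)
    show "integrable M (\<lambda>\<omega>. X (Suc N) \<omega> ^ j * S N \<omega> ^ k)"
      by (rule indep_var_integrable[OF ind]) (auto intro: intX intS)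
  qed
  have "\<exists>c\<ge>0. \<forall>N. expectation (\<lambda>\<omega>. S N \<omega> ^ (2 * n)) \<le> c * real N ^ n"
  proof (induction n)
    case 0
    show ?case by (intro exI[of _ 1]) (simp add: prob_space)
  next
    case (Suc n)
    then obtain c where c: "c \<ge> 0" "\<And>N. expectation (\<lambda>\<omega>. S N \<omega> ^ (2 * n)) \<le> c * real N ^ n"
      by blast
    define q where "q = 2 * Suc n"
    \<comment> \<open>\<open>K\<close> collects the binomial coefficients, the moment bounds
      \<open>m j\<close> of the new summand and the constant 1 + c of \<open>low\<close> for the
      moments of the old sum.\<close>
    define K where "K = (\<Sum>j=2..q. real (q choose j) * (m j * (1 + c)))"
    have K: "K \<ge> 0" unfolding K_def using m c by (intro sum_nonneg) simp
    \<comment> \<open>The power \<open>Suc N\<close>, not \<open>N\<close>, absorbs the additive 1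
      even when N = 0.\<close>
    have low: "\<bar>expectation (\<lambda>\<omega>. S N \<omega> ^ k)\<bar> \<le> (1 + c) * real (Suc N) ^ n" if "k \<le> 2 * n" for N k
    proof -
      have "\<bar>expectation (\<lambda>\<omega>. S N \<omega> ^ k)\<bar> \<le> expectation (\<lambda>\<omega>. \<bar>S N \<omega> ^ k\<bar>)"
        by (rule integral_abs_bound)
      also have "\<dots> \<le> expectation (\<lambda>\<omega>. 1 + S N \<omega> ^ (2 * n))"
      proof (rule integral_mono)
        show "integrable M (\<lambda>\<omega>. \<bar>S N \<omega> ^ k\<bar>)" by (rule integrable_abs[OF intS])
        show "integrable M (\<lambda>\<omega>. 1 + S N \<omega> ^ (2 * n))" by (simp add: intS)
        show "\<bar>S N \<omega> ^ k\<bar> \<le> 1 + S N \<omega> ^ (2 * n)" for \<omega>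
          using power_le_one_plus_power[OF abs_ge_zero that, of "S N \<omega>"]
          by (simp add: power_abs power_even_abs)
      qed
      also have "\<dots> = 1 + expectation (\<lambda>\<omega>. S N \<omega> ^ (2 * n))"
        by (simp add: intS prob_space)
      also have "\<dots> \<le> real (Suc N) ^ n + c * real (Suc N) ^ n"
        using c by (intro add_mono order_trans[OF c(2)] mult_left_mono power_mono one_le_power) auto
      finally show ?thesis by (simp add: algebra_simps)
    qed
    have step: "expectation (\<lambda>\<omega>. S (Suc N) \<omega> ^ q) \<le> expectation (\<lambda>\<omega>. S N \<omega> ^ q) + K * real (Suc N) ^ n" for N
    proof -
      let ?e = "\<lambda>j. real (q choose j) * (expectation (\<lambda>\<omega>. X (Suc N) \<omega> ^ j) * expectation (\<lambda>\<omega>. S N \<omega> ^ (q - j)))"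
      have "S (Suc N) \<omega> ^ q = (\<Sum>j\<le>q. real (q choose j) * (X (Suc N) \<omega> ^ j * S N \<omega> ^ (q - j)))" for \<omega>
      proof -
        have "S (Suc N) \<omega> = X (Suc N) \<omega> + S N \<omega>" by (simp add: S_def)
        then show ?thesis by (simp only: binomial_ring mult.assoc)
      qed
      then have "expectation (\<lambda>\<omega>. S (Suc N) \<omega> ^ q) = (\<Sum>j\<le>q. ?e j)"
        by (simp add: prodI prodE)
      \<comment> \<open>The index 0 reproduces the previous moment, the index 1 is killed by
        centering, and from 2 on the exponent q - j is at most 2n, so that \<open>low\<close>
        applies.\<close>
      also have "{..q} = insert 0 (insert 1 {2..q})" by (auto simp: q_def)
      also have "(\<Sum>j\<in>insert 0 (insert 1 {2..q}). ?e j) = ?e 0 + (?e 1 + (\<Sum>j=2..q. ?e j))" by simp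
      also have "?e 0 = expectation (\<lambda>\<omega>. S N \<omega> ^ q)" by (simp add: prob_space)
      also have "?e 1 = 0" by (simp add: centered)
      also have "(\<Sum>j=2..q. ?e j) \<le> (\<Sum>j=2..q. real (q choose j) * (m j * ((1 + c) * real (Suc N) ^ n)))"
      proof (intro sum_mono mult_left_mono)
        fix j assume j: "j \<in> {2..q}"
        have "\<bar>expectation (\<lambda>\<omega>. X (Suc N) \<omega> ^ j)\<bar> \<le> expectation (\<lambda>\<omega>. \<bar>X (Suc N) \<omega> ^ j\<bar>)"
          by (rule integral_abs_bound)
        also have "\<dots> \<le> m j" using m(2)[of "Suc N" j] by (simp add: power_abs)
        finally have "\<bar>expectation (\<lambda>\<omega>. X (Suc N) \<omega> ^ j) * expectation (\<lambda>\<omega>. S N \<omega> ^ (q - j))\<bar>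
          \<le> m j * ((1 + c) * real (Suc N) ^ n)"
          unfolding abs_mult using j m(1) by (intro mult_mono low) (auto simp: q_def)
        then show "expectation (\<lambda>\<omega>. X (Suc N) \<omega> ^ j) * expectation (\<lambda>\<omega>. S N \<omega> ^ (q - j))
          \<le> m j * ((1 + c) * real (Suc N) ^ n)" by linarith
      qed simp
      also have "\<dots> = K * real (Suc N) ^ n"
        by (simp add: K_def sum_distrib_right mult.assoc)
      finally show ?thesis by simp
    qed
    have "expectation (\<lambda>\<omega>. S N \<omega> ^ q) \<le> K * real N ^ Suc n" for N
    proof (induction N)
      case 0
      then show ?case by (simp add: S_def q_def)
    next
      case (Suc N)
      have "expectation (\<lambda>\<omega>. S (Suc N) \<omega> ^ q) \<le> K * real N ^ Suc n + K * real (Suc N) ^ n"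
        using step[of N] Suc by linarith
      also have "\<dots> = K * (real N * real N ^ n + real (Suc N) ^ n)" by (simp add: algebra_simps)
      also have "\<dots> \<le> K * (real N * real (Suc N) ^ n + real (Suc N) ^ n)"
        using K by (intro mult_left_mono add_mono power_mono) auto
      also have "\<dots> = K * real (Suc N) ^ Suc n" by (simp add: algebra_simps)
      finally show ?case .
    qed
    then show ?case using K unfolding q_def by blast
  qed
  then show ?thesis using intS by blast
qed

text \<open>The square of sqrt N * (S / N) is S^2 / N, whose n-th power is S^(2n) / N^n: exactly
  what the even-moment bound keeps bounded in mean. Powers of other orders are reduced to even
  ones.\<close>

lemma moment_bounded_centered_average:
  fixes X :: "nat \<Rightarrow> 'a \<Rightarrow> real"
  assumes indep: "indep_vars (\<lambda>_. borel) X {1..}"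
    and mb: "moment_bounded M {1..} X"
    and centered: "\<And>i. i \<ge> 1 \<Longrightarrow> expectation (X i) = 0"
  shows "moment_bounded M {2..} (\<lambda>N \<omega>. sqrt (real N) * ((\<Sum>i=1..N. X i \<omega>) / real N))"
proof -
  define S where "S = (\<lambda>N \<omega>. \<Sum>i=1..N. X i \<omega>)"
  have [measurable]: "X i \<in> borel_measurable M" if "i \<ge> 1" for i
    using indep that by (auto simp: indep_vars_def)
  have measS[measurable]: "S N \<in> borel_measurable M" for N unfolding S_def by measurable
  have S: "integrable M (\<lambda>\<omega>. S N \<omega> ^ k)"
    "\<exists>c\<ge>0. \<forall>N. expectation (\<lambda>\<omega>. S N \<omega> ^ (2 * n)) \<le> c * real N ^ n" for N k n
    using centered_sum_even_moment[OF assms] unfolding S_def by blast+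
  show ?thesis
  proof (rule moment_boundedI[where V = "\<lambda>N \<omega>. \<bar>sqrt (real N) * (S N \<omega> / real N)\<bar>"])
    show "(\<lambda>\<omega>. \<bar>sqrt (real N) * (S N \<omega> / real N)\<bar>) \<in> borel_measurable M" for N
      by measurable
    show "\<bar>sqrt (real N) * ((\<Sum>i=1..N. X i \<omega>) / real N)\<bar> \<le> \<bar>sqrt (real N) * (S N \<omega> / real N)\<bar>"
      for N \<omega> by (simp only: S_def order_refl)
    fix n :: nat
    obtain c where c: "c \<ge> 0" "\<And>N. expectation (\<lambda>\<omega>. S N \<omega> ^ (2 * n)) \<le> c * real N ^ n"
      using S(2) by blast
    have "(\<integral>\<^sup>+\<omega>. ennreal (\<bar>sqrt (real N) * (S N \<omega> / real N)\<bar> ^ n) \<partial>M) \<le> ennreal (1 + c)"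
      if N: "N \<in> {2..}" for N
    proof -
      have "(\<integral>\<^sup>+\<omega>. ennreal (\<bar>sqrt (real N) * (S N \<omega> / real N)\<bar> ^ n) \<partial>M)
        \<le> (\<integral>\<^sup>+\<omega>. ennreal (1 + S N \<omega> ^ (2 * n) / real N ^ n) \<partial>M)"
      proof (intro nn_integral_mono ennreal_leI)
        fix \<omega>
        let ?u = "sqrt (real N) * (S N \<omega> / real N)"
        have "\<bar>?u\<bar> ^ n \<le> 1 + \<bar>?u\<bar> ^ (2 * n)"
          by (rule power_le_one_plus_power) auto
        also have "\<bar>?u\<bar> ^ (2 * n) = (?u\<^sup>2) ^ n" by (simp only: power_mult power2_abs)
        also have "?u\<^sup>2 = (S N \<omega>)\<^sup>2 / real N"
        proof -
          have "?u\<^sup>2 = real N * ((S N \<omega>)\<^sup>2 / (real N)\<^sup>2)"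
            by (simp only: power_mult_distrib power_divide real_sqrt_pow2 of_nat_0_le_iff)
          then show ?thesis using N by (simp add: power2_eq_square)
        qed
        also have "\<dots> ^ n = S N \<omega> ^ (2 * n) / real N ^ n"
          by (simp add: power_divide power_mult)
        finally show "\<bar>?u\<bar> ^ n \<le> 1 + S N \<omega> ^ (2 * n) / real N ^ n" .
      qed
      also have "\<dots> = ennreal (expectation (\<lambda>\<omega>. 1 + S N \<omega> ^ (2 * n) / real N ^ n))"
        by (intro nn_integral_eq_integral) (simp add: S, simp add: power_mult)
      also have "expectation (\<lambda>\<omega>. 1 + S N \<omega> ^ (2 * n) / real N ^ n)
          = 1 + expectation (\<lambda>\<omega>. S N \<omega> ^ (2 * n)) / real N ^ n"
        by (simp add: S prob_space)
      also have "\<dots> \<le> 1 + c" using c(2)[of N] N by (simp add: divide_le_eq)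
      finally show ?thesis by (simp add: ennreal_leI)
    qed
    then show "\<exists>c. \<forall>N\<in>{2..}. (\<integral>\<^sup>+\<omega>. ennreal (\<bar>sqrt (real N) * (S N \<omega> / real N)\<bar> ^ n) \<partial>M) \<le> ennreal c"
      by blast
  qed
qed

text \<open>Reduction to coordinates through the l1 bound on the norm. A general Euclidean space
  covers both vectors, for the empirical mean, and matrices, for the empirical second
  moments.\<close>

lemma moment_bounded_average_deviation:
  fixes X :: "nat \<Rightarrow> 'a \<Rightarrow> 'b::euclidean_space"
  assumes indep: "indep_vars (\<lambda>_. borel) X {1..}"
    and mb: "moment_bounded M {1..} (\<lambda>i \<omega>. norm (X i \<omega>))"
    and mean: "\<And>i. i \<ge> 1 \<Longrightarrow> expectation (X i) = \<mu>"
  shows "moment_bounded M {2..}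
    (\<lambda>N \<omega>. sqrt (real N) * norm ((1 / real N) *\<^sub>R (\<Sum>i=1..N. X i \<omega>) - \<mu>))"
proof -
  have [measurable]: "X i \<in> borel_measurable M" if "i \<ge> 1" for i
    using indep that by (auto simp: indep_vars_def)
  have intX: "integrable M (X i)" if "i \<ge> 1" for i
    using moment_bounded_integrable[OF mb, of i] that by (simp add: integrable_norm_iff)
  have coord: "moment_bounded M {2..}
    (\<lambda>N \<omega>. sqrt (real N) * ((\<Sum>i=1..N. (X i \<omega> - \<mu>) \<bullet> b) / real N))" if b: "b \<in> Basis" for b
  proof (rule moment_bounded_centered_average)
    show "indep_vars (\<lambda>_. borel) (\<lambda>i \<omega>. (X i \<omega> - \<mu>) \<bullet> b) {1..}"
      by (rule indep_vars_compose2[OF indep]) measurable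
    show "moment_bounded M {1..} (\<lambda>i \<omega>. (X i \<omega> - \<mu>) \<bullet> b)"
    proof (rule moment_bounded_mono)
      show "moment_bounded M {1..} (\<lambda>i \<omega>. norm (X i \<omega>) + norm \<mu>)"
        by (intro moment_bounded_add moment_bounded_const mb)
      show "\<bar>(X i \<omega> - \<mu>) \<bullet> b\<bar> \<le> norm (X i \<omega>) + norm \<mu>" for i \<omega>
        using Basis_le_norm[OF b, of "X i \<omega> - \<mu>"] norm_triangle_ineq4[of "X i \<omega>" \<mu>] by linarith
    qed
    show "expectation (\<lambda>\<omega>. (X i \<omega> - \<mu>) \<bullet> b) = 0" if "i \<ge> 1" for i
      using intX[OF that] mean[OF that] by (simp add: prob_space)
  qed
  show ?thesis
  proof (rule moment_bounded_mono)
    show "moment_bounded M {2..}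
      (\<lambda>N \<omega>. \<Sum>b\<in>Basis. \<bar>sqrt (real N) * ((\<Sum>i=1..N. (X i \<omega> - \<mu>) \<bullet> b) / real N)\<bar>)"
      by (intro moment_bounded_sum moment_bounded_abs coord)
    fix N :: nat and \<omega> assume N: "N \<in> {2..}"
    let ?d = "(1 / real N) *\<^sub>R (\<Sum>i=1..N. X i \<omega>) - \<mu>"
    have "?d \<bullet> b = (\<Sum>i=1..N. (X i \<omega> - \<mu>) \<bullet> b) / real N" for b
      using N by (simp add: inner_diff_left inner_sum_left sum_subtractf diff_divide_distrib)
    then have "norm ?d \<le> (\<Sum>b\<in>Basis. \<bar>(\<Sum>i=1..N. (X i \<omega> - \<mu>) \<bullet> b) / real N\<bar>)"
      using norm_le_l1[of ?d] by simp
    then have "sqrt (real N) * norm ?d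
      \<le> sqrt (real N) * (\<Sum>b\<in>Basis. \<bar>(\<Sum>i=1..N. (X i \<omega> - \<mu>) \<bullet> b) / real N\<bar>)"
      by (intro mult_left_mono) auto
    also have "\<dots> = (\<Sum>b\<in>Basis. sqrt (real N) * \<bar>(\<Sum>i=1..N. (X i \<omega> - \<mu>) \<bullet> b) / real N\<bar>)"
      by (rule sum_distrib_left)
    finally show "\<bar>sqrt (real N) * norm ?d\<bar>
      \<le> (\<Sum>b\<in>Basis. \<bar>sqrt (real N) * ((\<Sum>i=1..N. (X i \<omega> - \<mu>) \<bullet> b) / real N)\<bar>)"
      by (simp only: abs_mult abs_norm_cancel real_sqrt_ge_zero of_nat_0_le_iff abs_of_nonneg)
  qed
qed

end

subsection \<open>Matrices and the Kalman gain\<close>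

text \<open>Cauchy-Schwarz in every row.\<close>

lemma norm_matrix_vector_mult_le:
  fixes A :: "real ^ 'n ^ 'm"
  shows "norm (A *v x) \<le> norm A * norm x"
proof -
  have "norm (A *v x) \<le> L2_set (\<lambda>i. norm (A $ i) * norm x) UNIV"
    unfolding norm_vec_def[of "A *v x"]
    by (rule L2_set_mono) (auto simp: matrix_vector_mul_component Cauchy_Schwarz_ineq2)
  also have "\<dots> = norm A * norm x"
    by (simp add: norm_vec_def[of A] L2_set_left_distrib)
  finally show ?thesis .
qed

lemma spectral_norm_nonneg: "0 \<le> spectral_norm A"
  unfolding spectral_norm_def by (intro onorm_pos_le matrix_vector_mul_bounded_linear)

lemma norm_matrix_vector_mult_le_spectral: "norm (A *v x) \<le> spectral_norm A * norm x"
  unfolding spectral_norm_def by (intro onorm matrix_vector_mul_bounded_linear)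

text \<open>The condition on \<open>T\<close> is stated in spectral norms while all deviations are
  measured in the Frobenius norm. This one-sided comparison suffices, because the spectral norm of a
  difference of values of \<open>T\<close> is used directly as an operator bound.\<close>

lemma spectral_norm_le_norm: "spectral_norm A \<le> norm A"
  unfolding spectral_norm_def by (intro onorm_bound norm_matrix_vector_mult_le norm_ge_zero)

lemma spectral_norm_triangle_sub:
  "spectral_norm A \<le> spectral_norm B + spectral_norm (A - B)"
proof -
  have "(\<lambda>x. A *v x) = (\<lambda>x. B *v x + (A - B) *v x)"
    by (simp add: matrix_vector_mult_diff_rdistrib)
  then show ?thesis
    unfolding spectral_norm_def
    using onorm_triangle[OF matrix_vector_mul_bounded_linear[of B]
        matrix_vector_mul_bounded_linear[of "A - B"]] by simp
qed

lemma norm_outer: "norm (outer x y) = norm x * norm y"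
proof -
  have "outer x y $ i = x $ i *\<^sub>R y" for i by (simp add: outer_def vec_eq_iff)
  then have "norm (outer x y) = L2_set (\<lambda>i. norm (x $ i) * norm y) UNIV"
    by (simp add: norm_vec_def[of "outer x y"])
  also have "\<dots> = norm x * norm y" by (simp add: norm_vec_def[of x] L2_set_left_distrib)
  finally show ?thesis .
qed

interpretation outer: bounded_bilinear outer
proof
  show "outer (a + a') b = outer a b + outer a' b" for a a' :: "real ^ 'a" and b :: "real ^ 'b"
    by (simp add: outer_def vec_eq_iff algebra_simps)
  show "outer a (b + b') = outer a b + outer a b'" for a :: "real ^ 'a" and b b' :: "real ^ 'b"
    by (simp add: outer_def vec_eq_iff algebra_simps)
  show "outer (r *\<^sub>R a) b = r *\<^sub>R outer a b" for r and a :: "real ^ 'a" and b :: "real ^ 'b"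
    by (simp add: outer_def vec_eq_iff algebra_simps)
  show "outer a (r *\<^sub>R b) = r *\<^sub>R outer a b" for r and a :: "real ^ 'a" and b :: "real ^ 'b"
    by (simp add: outer_def vec_eq_iff algebra_simps)
  show "\<exists>K. \<forall>(a :: real ^ 'a) (b :: real ^ 'b). norm (outer a b) \<le> norm a * norm b * K"
    by (intro exI[of _ 1]) (simp add: norm_outer)
qed

lemma outer_matrix_vector_mult: "outer a b *v x = (b \<bullet> x) *\<^sub>R a"
  by (simp add: vec_eq_iff outer_def matrix_vector_mult_def inner_vec_def sum_distrib_left mult_ac)

section \<open>Positive semidefinite matrices and covariances\<close>

lemma pos_semidef_zero: "pos_semidef 0"
  by (simp add: pos_semidef_def transpose_def vec_eq_iff)

lemma pos_semidef_outer: "pos_semidef (outer a a)"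
  unfolding pos_semidef_def
  by (auto simp: outer_matrix_vector_mult inner_commute)
     (simp add: transpose_def outer_def vec_eq_iff)

lemma pos_semidef_scaleR:
  assumes "0 \<le> c" "pos_semidef A"
  shows "pos_semidef (c *\<^sub>R A)"
proof -
  have "transpose (c *\<^sub>R A) = c *\<^sub>R transpose A" by (simp add: transpose_def vec_eq_iff)
  then show ?thesis
    using assms by (simp add: pos_semidef_def scaleR_matrix_vector_assoc[symmetric])
qed

lemma pos_semidef_sum:
  assumes "\<And>i. i \<in> S \<Longrightarrow> pos_semidef (A i)"
  shows "pos_semidef (\<Sum>i\<in>S. A i)"
proof -
  have "pos_semidef (P + P')" if "pos_semidef P" "pos_semidef P'" for P P' :: "real ^ 'n ^ 'n"
  proof -
    have "transpose (P + P') = transpose P + transpose P'" by (simp add: transpose_def vec_eq_iff)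
    then show ?thesis
      using that by (simp add: pos_semidef_def matrix_vector_mult_add_rdistrib inner_add_right)
  qed
  then show ?thesis
    using assms by (induction S rule: infinite_finite_induct) (auto intro: pos_semidef_zero)
qed

lemma pos_semidef_ens_cov: "2 \<le> M \<Longrightarrow> pos_semidef (ens_cov M x)"
  unfolding ens_cov_def
  by (intro pos_semidef_scaleR pos_semidef_sum pos_semidef_outer) simp

lemma pos_semidef_integral:
  fixes F :: "'w \<Rightarrow> real ^ 'n ^ 'n"
  assumes "\<And>\<omega>. pos_semidef (F \<omega>)"
  shows "pos_semidef (\<integral>\<omega>. F \<omega> \<partial>\<P>)"
proof (cases "integrable \<P> F")
  \<comment> \<open>A non-integrable function has Bochner integral 0, which is positive
    semidefinite; so \<open>law_cov\<close> is covered without a moment condition.\<close>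
  case False
  then show ?thesis by (simp add: not_integrable_integral_eq pos_semidef_zero)
next
  case True
  \<comment> \<open>Transposition and, below, the quadratic form at a fixed vector are bounded
    linear in the matrix and commute with the integral.\<close>
  have "linear (transpose :: real ^ 'n ^ 'n \<Rightarrow> _)"
    by (rule linearI) (simp_all add: transpose_def vec_eq_iff)
  then have "bounded_linear (transpose :: real ^ 'n ^ 'n \<Rightarrow> _)"
    by (simp add: linear_conv_bounded_linear)
  note tr_int = integral_bounded_linear[OF this True]
  have tr: "transpose (\<integral>\<omega>. F \<omega> \<partial>\<P>) = (\<integral>\<omega>. F \<omega> \<partial>\<P>)"
  proof -
    have "transpose (F \<omega>) = F \<omega>" for \<omega> using assms by (simp add: pos_semidef_def)
    then have "(\<lambda>\<omega>. transpose (F \<omega>)) = F" by auto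
    with tr_int show ?thesis by simp
  qed
  have "0 \<le> x \<bullet> ((\<integral>\<omega>. F \<omega> \<partial>\<P>) *v x)" for x
  proof -
    have "linear (\<lambda>A :: real ^ 'n ^ 'n. x \<bullet> (A *v x))"
      by (rule linearI)
         (simp_all add: matrix_vector_mult_add_rdistrib inner_add_right scaleR_matrix_vector_assoc[symmetric])
    then have "bounded_linear (\<lambda>A :: real ^ 'n ^ 'n. x \<bullet> (A *v x))"
      by (simp add: linear_conv_bounded_linear)
    from integral_bounded_linear[OF this True]
    have "x \<bullet> ((\<integral>\<omega>. F \<omega> \<partial>\<P>) *v x) = (\<integral>\<omega>. x \<bullet> (F \<omega> *v x) \<partial>\<P>)" by simp
    also have "\<dots> \<ge> 0"
      using assms by (intro integral_nonneg_AE) (simp add: pos_semidef_def)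
    finally show ?thesis .
  qed
  then show ?thesis using tr by (simp add: pos_semidef_def)
qed

lemma pos_semidef_law_cov: "pos_semidef (law_cov \<P> X)"
  unfolding law_cov_def by (intro pos_semidef_integral pos_semidef_outer)

text \<open>The constant is the minimum of the quadratic form on the unit sphere, attained by
  compactness and hence positive; homogeneity of degree two extends the bound to all
  vectors.\<close>

lemma pos_def_coercive:
  fixes R :: "real ^ 'q ^ 'q"
  assumes "pos_def R"
  obtains \<kappa> where "\<kappa> > 0" "\<And>x. \<kappa> * (norm x)\<^sup>2 \<le> x \<bullet> (R *v x)"
proof -
  have "sphere 0 1 \<noteq> ({} :: (real ^ 'q) set)"
    using SOME_Basis norm_Basis by (metis mem_sphere_0 empty_iff)
  moreover have "continuous_on (sphere 0 1) (\<lambda>x. x \<bullet> (R *v x))"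
    by (intro continuous_intros matrix_vector_mult_linear_continuous_on)
  ultimately obtain x0 where x0: "x0 \<in> sphere 0 1"
    "\<And>x. x \<in> sphere 0 1 \<Longrightarrow> x0 \<bullet> (R *v x0) \<le> x \<bullet> (R *v x)"
    using continuous_attains_inf[of "sphere (0 :: real ^ 'q) 1" "\<lambda>x. x \<bullet> (R *v x)"] compact_sphere
    by blast
  show thesis
  proof
    show "x0 \<bullet> (R *v x0) > 0"
    proof -
      have "x0 \<noteq> 0" using x0(1) by auto
      then show ?thesis using assms by (simp add: pos_def_def)
    qed
    fix x :: "real ^ 'q"
    show "x0 \<bullet> (R *v x0) * (norm x)\<^sup>2 \<le> x \<bullet> (R *v x)"
    proof (cases "x = 0")
      case False
      let ?u = "(1 / norm x) *\<^sub>R x"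
      have "x0 \<bullet> (R *v x0) \<le> ?u \<bullet> (R *v ?u)" using False by (intro x0(2)) simp
      also have "\<dots> = (x \<bullet> (R *v x)) / (norm x)\<^sup>2"
        by (simp add: matrix_vector_mult_scaleR power2_eq_square)
      finally show ?thesis using False by (simp add: field_simps)
    qed simp
  qed
qed

text \<open>Finite-dimensional Lax-Milgram: Cauchy-Schwarz turns coercivity into a lower bound for
  the norm of A x, so A is injective and therefore invertible.\<close>

lemma coercive_matrix_inv:
  fixes A :: "real ^ 'q ^ 'q"
  assumes "\<kappa> > 0" "\<And>x. \<kappa> * (norm x)\<^sup>2 \<le> x \<bullet> (A *v x)"
  shows "\<kappa> * norm x \<le> norm (A *v x)" and "A *v (matrix_inv A *v x) = x"
proof -
  have lower: "\<kappa> * norm x \<le> norm (A *v x)" for x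
  proof (cases "x = 0")
    case False
    have "\<kappa> * (norm x)\<^sup>2 \<le> norm x * norm (A *v x)"
      using assms(2)[of x] norm_cauchy_schwarz[of x "A *v x"] by linarith
    then show ?thesis using False by (simp add: power2_eq_square)
  qed simp
  then show "\<kappa> * norm x \<le> norm (A *v x)" .
  have "inj ((*v) A)"
  proof (rule injI)
    fix u v assume "A *v u = A *v v"
    then have "\<kappa> * norm (u - v) \<le> 0" using lower[of "u - v"] by (simp add: matrix_vector_mult_diff_distrib)
    then show "u = v" using assms(1) by (simp add: mult_le_0_iff)
  qed
  then have "invertible A"
    by (simp add: invertible_left_inverse matrix_left_invertible_injective)
  \<comment> \<open>\<open>matrix_inv\<close> is a choice and is known to be an inverse only once
    invertibility has been shown.\<close>
  then have "A ** matrix_inv A = mat 1"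
    unfolding matrix_inv_def invertible_def by (rule someI2_ex) blast
  then show "A *v (matrix_inv A *v x) = x" by (simp add: matrix_vector_mul_assoc)
qed

text \<open>The base point P is fixed and may enter the constant; P' is arbitrary and must not. This
  works because the coercivity constant of \<open>R\<close> is inherited by R + H P' H^T for every
  positive semidefinite P', which bounds all the inverses at once.\<close>

lemma kalman_gain_lipschitz_at:
  fixes H :: "real ^ 'd ^ 'q" and R :: "real ^ 'q ^ 'q"
  assumes R: "pos_def R" and P: "pos_semidef P"
  obtains c where "0 \<le> c" "\<And>P' u. pos_semidef P' \<Longrightarrow>
    norm (kalman_gain H R P' *v u - kalman_gain H R P *v u) \<le> c * norm (P' - P) * norm u"
proof -
  obtain \<kappa> where l: "\<kappa> > 0" "\<And>x. \<kappa> * (norm x)\<^sup>2 \<le> x \<bullet> (R *v x)"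
    using pos_def_coercive[OF R] by blast
  define A where "A = (\<lambda>P'. R + H ** P' ** transpose H)"
  have mv: "A P' *v x = R *v x + H *v (P' *v (transpose H *v x))" for P' x
    by (simp add: A_def matrix_vector_mult_add_rdistrib matrix_vector_mul_assoc[symmetric])
  have gain: "kalman_gain H R P' *v u = P' *v (transpose H *v (matrix_inv (A P') *v u))" for P' u
    by (simp add: kalman_gain_def A_def matrix_vector_mul_assoc[symmetric])
  have coer: "\<kappa> * (norm x)\<^sup>2 \<le> x \<bullet> (A P' *v x)" if "pos_semidef P'" for P' x
  proof -
    have "x \<bullet> (H *v (P' *v (transpose H *v x)))
        = (transpose H *v x) \<bullet> (P' *v (transpose H *v x))"
      by (simp only: transpose_matrix_vector dot_lmul_matrix)
    also have "\<dots> \<ge> 0" using that by (simp add: pos_semidef_def)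
    finally show ?thesis using l(2)[of x] by (simp add: mv inner_add_right)
  qed
  define h h' where "h = norm H" and "h' = norm (transpose H)"
  have hh: "0 \<le> h" "0 \<le> h'" by (simp_all add: h_def h'_def)
  note bd = norm_matrix_vector_mult_le
  show thesis
  \<comment> \<open>The first summand bounds the action of P' - P on H^T v', the second that of P on
    H^T (v' - v). In the latter, one division by \<kappa> comes from the size of v' and one from
    inverting A(P).\<close>
  proof (rule that[of "h' / \<kappa> + norm P * h' * (h * h' / \<kappa> / \<kappa>)"])
    show "0 \<le> h' / \<kappa> + norm P * h' * (h * h' / \<kappa> / \<kappa>)" using hh l(1) by simp
    fix P' :: "real ^ 'd ^ 'd" and u :: "real ^ 'q" assume P': "pos_semidef P'"
    define v' v where "v' = matrix_inv (A P') *v u" and "v = matrix_inv (A P) *v u"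
    have v': "A P' *v v' = u" and v: "A P *v v = u"
      unfolding v'_def v_def by (rule coercive_matrix_inv(2)[OF l(1) coer[OF P']],
          rule coercive_matrix_inv(2)[OF l(1) coer[OF P]])
    have nv': "norm v' \<le> norm u / \<kappa>"
      using coercive_matrix_inv(1)[OF l(1) coer[OF P'], of v'] v' l(1) by (simp add: field_simps)
    have hv': "norm (transpose H *v v') \<le> h' * (norm u / \<kappa>)"
      using bd[of "transpose H" v'] mult_left_mono[OF nv' hh(2)] by (simp add: h'_def)
    have d1: "norm ((P' - P) *v (transpose H *v v')) \<le> norm (P' - P) * (h' * (norm u / \<kappa>))"
      by (rule order_trans[OF bd]) (intro mult_left_mono hv' norm_ge_zero)
    \<comment> \<open>The resolvent identity, written for the solutions v and v' of the two linear
      systems with the same right-hand side u.\<close>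
    have "A P *v (v - v') = H *v ((P' - P) *v (transpose H *v v'))"
    proof -
      have "A P *v (v - v') = A P' *v v' - A P *v v'"
        using v v' by (simp add: matrix_vector_mult_diff_distrib)
      then show ?thesis
        by (simp add: mv matrix_vector_mult_diff_distrib matrix_vector_mult_diff_rdistrib)
    qed
    then have "\<kappa> * norm (v - v') \<le> h * (norm (P' - P) * (h' * (norm u / \<kappa>)))"
      using coercive_matrix_inv(1)[OF l(1) coer[OF P], of "v - v'"]
        bd[of H "(P' - P) *v (transpose H *v v')"] mult_left_mono[OF d1 hh(1)]
      by (simp add: h_def)
    then have dv: "norm (v' - v) \<le> h * (norm (P' - P) * (h' * (norm u / \<kappa>))) / \<kappa>"
      using l(1) by (simp add: field_simps norm_minus_commute)
    have d2: "norm (P *v (transpose H *v (v' - v)))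
        \<le> norm P * (h' * (h * (norm (P' - P) * (h' * (norm u / \<kappa>))) / \<kappa>))"
    proof (rule order_trans[OF bd], rule mult_left_mono)
      show "norm (transpose H *v (v' - v)) \<le> h' * (h * (norm (P' - P) * (h' * (norm u / \<kappa>))) / \<kappa>)"
        using bd[of "transpose H" "v' - v"] mult_left_mono[OF dv hh(2)] by (simp add: h'_def)
    qed simp
    have eq: "kalman_gain H R P' *v u - kalman_gain H R P *v u
        = (P' - P) *v (transpose H *v v') + P *v (transpose H *v (v' - v))"
      by (simp add: gain v'_def v_def matrix_vector_mult_diff_distrib matrix_vector_mult_diff_rdistrib)
    have "norm (kalman_gain H R P' *v u - kalman_gain H R P *v u)
      \<le> norm (P' - P) * (h' * (norm u / \<kappa>))
        + norm P * (h' * (h * (norm (P' - P) * (h' * (norm u / \<kappa>))) / \<kappa>))"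
      unfolding eq by (intro norm_triangle_le add_mono d1 d2)
    also have "\<dots> = (h' / \<kappa> + norm P * h' * (h * h' / \<kappa> / \<kappa>)) * norm (P' - P) * norm u"
      by (simp add: algebra_simps)
    finally show "norm (kalman_gain H R P' *v u - kalman_gain H R P *v u)
      \<le> (h' / \<kappa> + norm P * h' * (h * h' / \<kappa> / \<kappa>)) * norm (P' - P) * norm u" .
  qed
qed

subsection \<open>Stability of the analysis step\<close>

text \<open>The data (m, P, z) belong to the mean-field side and (m', P', x) to the ensemble. The
  constant depends on y, m and P only, and every term of the bound contains one of the small
  quantities |x - z|, |m' - m|, |P' - P| as a factor: that factor will later receive sqrt M, while
  the remaining ones stay bounded in all moments.\<close>

lemma analysis_map_stability:
  fixes H :: "real ^ 'd ^ 'q" and R :: "real ^ 'q ^ 'q" and T :: "real ^ 'd ^ 'd \<Rightarrow> real ^ 'd ^ 'd"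
  assumes R: "pos_def R" and P: "pos_semidef P" and L: "L > 0"
    and T: "\<And>P P'. pos_semidef P \<Longrightarrow> pos_semidef P' \<Longrightarrow>
      spectral_norm (T P - T P')
        \<le> L * (1 + (spectral_norm P)\<^sup>2 + (spectral_norm P')\<^sup>2) * spectral_norm (P - P')"
  obtains c where "0 \<le> c" "\<And>m' P' x z. pos_semidef P' \<Longrightarrow>
    norm (analysis_map H R T y m' P' x - analysis_map H R T y m P z)
      \<le> c * ((1 + norm (P' - P)) ^ 3 *
          (norm (x - z) + (norm (m' - m) + norm (P' - P)) * (1 + norm (m' - m) + norm (z - m))))"
proof -
  obtain cK where cK: "0 \<le> cK" "\<And>P' u. pos_semidef P' \<Longrightarrow>
    norm (kalman_gain H R P' *v u - kalman_gain H R P *v u) \<le> cK * norm (P' - P) * norm u"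
    using kalman_gain_lipschitz_at[OF R P] by metis
  \<comment> \<open>\<tau> is the local Lipschitz factor of \<open>T\<close> at P: with spectral
    norm s of P, the factor 1 + |P'|^2 + |P|^2 is at most 2 (1 + s)^2 (1 + \<delta>)^2.\<close>
  define a h k s \<tau> \<sigma> where "a = norm (y - H *v m)" and "h = norm H"
    and "k = norm (kalman_gain H R P)" and "s = spectral_norm P"
    and "\<tau> = 2 * L * (1 + s)\<^sup>2" and "\<sigma> = spectral_norm (T P)"
  have nonneg: "0 \<le> a" "0 \<le> h" "0 \<le> k" "0 \<le> s" "0 \<le> \<tau>" "0 \<le> \<sigma>"
    using L by (auto simp: a_def h_def k_def s_def \<tau>_def \<sigma>_def spectral_norm_nonneg)
  \<comment> \<open>The five summands belong, in order, to the five terms of the decomposition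
    \<open>eq\<close> below.\<close>
  define c where "c = 1 + cK * (a + h) + k * h + (\<sigma> + \<tau>) + \<tau>"
  show thesis
  proof (rule that[of c])
    show "0 \<le> c" using nonneg cK(1) by (simp add: c_def)
    fix m' x z and P' :: "real ^ 'd ^ 'd" assume P': "pos_semidef P'"
    define d \<delta> e \<zeta> where "d = norm (m' - m)" and "\<delta> = norm (P' - P)"
      and "e = norm (x - z)" and "\<zeta> = norm (z - m)"
    have nn: "0 \<le> d" "0 \<le> \<delta>" "0 \<le> e" "0 \<le> \<zeta>" by (auto simp: d_def \<delta>_def e_def \<zeta>_def)
    define G where "G = (1 + \<delta>) ^ 3 * (e + (d + \<delta>) * (1 + d + \<zeta>))"
    have g: "1 \<le> (1 + \<delta>) ^ 3" "(1 + \<delta>)\<^sup>2 \<le> (1 + \<delta>) ^ 3"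
      using nn by (auto intro: one_le_power power_increasing)
    have Q: "e + (d + \<delta>) * (1 + d + \<zeta>)
        = e + d + \<delta> + \<delta> * d + \<delta> * \<zeta> + d * d + d * \<zeta>" by (simp add: algebra_simps)
    have Qnn: "0 \<le> \<delta> * d" "0 \<le> \<delta> * \<zeta>" "0 \<le> d * d" "0 \<le> d * \<zeta>" using nn by simp_all
    have G1: "q \<le> G" if "q \<le> e + (d + \<delta>) * (1 + d + \<zeta>)" for q
    proof -
      have "1 * (e + (d + \<delta>) * (1 + d + \<zeta>)) \<le> G"
        unfolding G_def using nn by (intro mult_right_mono g) auto
      then show ?thesis using that by simp
    qed
    have G: "d \<le> G" "\<delta> \<le> G" "\<delta> * d \<le> G" using nn Qnn by (auto intro!: G1 simp: Q)
    have G2: "(1 + \<delta>) ^ 3 * (e + d) \<le> G"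
      unfolding G_def using nn Qnn g by (intro mult_left_mono) (auto simp: Q)
    have "\<delta> * \<zeta> \<le> e + (d + \<delta>) * (1 + d + \<zeta>)" using nn Qnn by (simp add: Q)
    then have G3: "(1 + \<delta>)\<^sup>2 * (\<delta> * \<zeta>) \<le> G"
      unfolding G_def using Qnn nn by (intro mult_mono g) auto
    have "spectral_norm P' \<le> s + \<delta>"
      using spectral_norm_triangle_sub[of P' P] spectral_norm_le_norm[of "P' - P"]
      by (simp add: s_def \<delta>_def)
    also have "\<dots> \<le> (1 + s) * (1 + \<delta>)" using nonneg nn by (simp add: algebra_simps)
    finally have "(spectral_norm P')\<^sup>2 \<le> ((1 + s) * (1 + \<delta>))\<^sup>2"
      by (intro power_mono spectral_norm_nonneg)
    moreover have "1 + s\<^sup>2 \<le> ((1 + s) * (1 + \<delta>))\<^sup>2"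
    proof -
      have "1 + s\<^sup>2 \<le> (1 + s)\<^sup>2" using nonneg by (simp add: power2_sum)
      also have "\<dots> \<le> ((1 + s) * (1 + \<delta>))\<^sup>2"
        using nonneg nn by (intro power_mono) (auto simp: algebra_simps)
      finally show ?thesis .
    qed
    ultimately have "1 + (spectral_norm P')\<^sup>2 + s\<^sup>2 \<le> 2 * ((1 + s)\<^sup>2 * (1 + \<delta>)\<^sup>2)"
      by (simp add: power_mult_distrib)
    then have "L * (1 + (spectral_norm P')\<^sup>2 + s\<^sup>2) * spectral_norm (P' - P)
      \<le> L * (2 * ((1 + s)\<^sup>2 * (1 + \<delta>)\<^sup>2)) * \<delta>"
      unfolding \<delta>_def using L
      by (intro mult_mono mult_left_mono spectral_norm_le_norm spectral_norm_nonneg) auto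
    then have dT: "spectral_norm (T P' - T P) \<le> \<tau> * ((1 + \<delta>)\<^sup>2 * \<delta>)"
      using T[OF P' P] by (simp add: \<tau>_def s_def mult_ac)
    \<comment> \<open>Origin of the cube in the statement: two powers from the quadratic growth in
      the condition on \<open>T\<close>, one from the increment \<delta> itself.\<close>
    have "(1 + \<delta>)\<^sup>2 * \<delta> \<le> (1 + \<delta>) ^ 3"
      using nn by (simp add: power3_eq_cube power2_eq_square algebra_simps)
    then have "spectral_norm (T P') \<le> \<sigma> * 1 + \<tau> * (1 + \<delta>) ^ 3"
      using spectral_norm_triangle_sub[of "T P'" "T P"] dT nonneg(5) mult_left_mono
      by (fastforce simp: \<sigma>_def)
    also have "\<dots> \<le> (\<sigma> + \<tau>) * (1 + \<delta>) ^ 3"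
      using mult_left_mono[OF g(1) nonneg(6)] by (simp add: distrib_right)
    finally have TP': "spectral_norm (T P') \<le> (\<sigma> + \<tau>) * (1 + \<delta>) ^ 3" .
    \<comment> \<open>The intermediate values are the gain at P applied to the innovation at m', and
      T P' applied to z - m. Hence the difference of the two values of \<open>T\<close> acts on the
      mean-field deviation z - m, whose moments are known.\<close>
    have eq: "analysis_map H R T y m' P' x - analysis_map H R T y m P z
      = (m' - m) + (kalman_gain H R P' *v (y - H *v m') - kalman_gain H R P *v (y - H *v m'))
        - kalman_gain H R P *v (H *v (m' - m))
        + T P' *v ((x - z) - (m' - m)) + (T P' - T P) *v (z - m)"
      by (simp add: analysis_map_def matrix_vector_mult_diff_distrib matrix_vector_mult_diff_rdistrib)
    have b2: "norm (kalman_gain H R P' *v (y - H *v m') - kalman_gain H R P *v (y - H *v m'))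
      \<le> cK * (a + h) * G"
    proof -
      have innov: "y - H *v m' = (y - H *v m) - H *v (m' - m)"
        by (simp add: matrix_vector_mult_diff_distrib)
      have "norm (y - H *v m') \<le> a + h * d"
        using norm_triangle_ineq4[of "y - H *v m" "H *v (m' - m)"]
          norm_matrix_vector_mult_le[of H "m' - m"]
        unfolding innov a_def h_def d_def by linarith
      then have "norm (kalman_gain H R P' *v (y - H *v m') - kalman_gain H R P *v (y - H *v m'))
        \<le> cK * \<delta> * (a + h * d)"
        using cK(1) nn by (intro order_trans[OF cK(2)[OF P']]) (auto simp: \<delta>_def intro!: mult_left_mono)
      also have "\<dots> = cK * (a * \<delta> + h * (\<delta> * d))" by (simp add: algebra_simps)
      also have "\<dots> \<le> cK * (a * G + h * G)"
        using cK(1) nonneg G by (intro mult_left_mono add_mono) auto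
      finally show ?thesis by (simp add: algebra_simps)
    qed
    have b3: "norm (kalman_gain H R P *v (H *v (m' - m))) \<le> k * h * G"
    proof -
      have "norm (kalman_gain H R P *v (H *v (m' - m))) \<le> k * (h * d)"
        unfolding k_def h_def d_def
        by (intro order_trans[OF norm_matrix_vector_mult_le] mult_left_mono
            norm_matrix_vector_mult_le norm_ge_zero)
      also have "\<dots> \<le> k * (h * G)" using nonneg G by (intro mult_left_mono) auto
      finally show ?thesis by simp
    qed
    have b4: "norm (T P' *v ((x - z) - (m' - m))) \<le> (\<sigma> + \<tau>) * G"
    proof -
      have "norm (T P' *v ((x - z) - (m' - m))) \<le> ((\<sigma> + \<tau>) * (1 + \<delta>) ^ 3) * (e + d)"
        using nonneg nn unfolding e_def d_def
        by (intro order_trans[OF norm_matrix_vector_mult_le_spectral] mult_mono TP'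
            norm_triangle_ineq4) auto
      also have "\<dots> \<le> (\<sigma> + \<tau>) * G"
        using mult_left_mono[OF G2, of "\<sigma> + \<tau>"] nonneg by (simp add: mult_ac)
      finally show ?thesis .
    qed
    have b5: "norm ((T P' - T P) *v (z - m)) \<le> \<tau> * G"
    proof -
      have "norm ((T P' - T P) *v (z - m)) \<le> (\<tau> * ((1 + \<delta>)\<^sup>2 * \<delta>)) * \<zeta>"
        unfolding \<zeta>_def
        by (intro order_trans[OF norm_matrix_vector_mult_le_spectral] mult_right_mono dT norm_ge_zero)
      also have "\<dots> \<le> \<tau> * G"
        using mult_left_mono[OF G3 nonneg(5)] by (simp add: mult_ac)
      finally show ?thesis .
    qed
    have triangle: "norm (v1 + v2 - v3 + v4 + v5) \<le> norm v1 + norm v2 + norm v3 + norm v4 + norm v5"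
      for v1 v2 v3 v4 v5 :: "real ^ 'd"
      using norm_triangle_ineq[of "v1 + v2 - v3 + v4" v5] norm_triangle_ineq[of "v1 + v2 - v3" v4]
        norm_triangle_ineq4[of "v1 + v2" v3] norm_triangle_ineq[of v1 v2] by linarith
    have "norm (analysis_map H R T y m' P' x - analysis_map H R T y m P z)
      \<le> G + cK * (a + h) * G + k * h * G + (\<sigma> + \<tau>) * G + \<tau> * G"
      unfolding eq by (rule order_trans[OF triangle], intro add_mono b2 b3 b4 b5)
        (use G(1) in \<open>simp add: d_def\<close>)
    also have "\<dots> = c * G" by (simp add: c_def algebra_simps)
    finally show "norm (analysis_map H R T y m' P' x - analysis_map H R T y m P z)
      \<le> c * ((1 + norm (P' - P)) ^ 3 *
          (norm (x - z) + (norm (m' - m) + norm (P' - P)) * (1 + norm (m' - m) + norm (z - m))))"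
      by (simp only: G_def d_def \<delta>_def e_def \<zeta>_def)
  qed
qed

text \<open>Steiner's shift to an arbitrary reference point m. With the deterministic mean-field
  mean in place of the empirical one, the sum has independent terms when x consists of the copies,
  and the price is the quadratic term in \<open>ens_mean M x - m\<close>.\<close>

lemma ens_cov_eq:
  assumes M: "2 \<le> M"
  shows "ens_cov M x = (real M / (real M - 1)) *\<^sub>R
    ((1 / real M) *\<^sub>R (\<Sum>i=1..M. outer (x i - m) (x i - m)) - outer (ens_mean M x - m) (ens_mean M x - m))"
proof -
  define d where "d = ens_mean M x - m"
  define u where "u = (\<lambda>i. x i - m)"
  have s: "(\<Sum>i=1..M. u i) = real M *\<^sub>R d"
    using M by (simp add: u_def d_def ens_mean_def sum_subtractf scaleR_diff_right sum_constant_scaleR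
        del: sum_constant)
  have shift: "x i - ens_mean M x = u i - d" for i by (simp add: d_def u_def)
  have "(\<Sum>i=1..M. outer (x i - ens_mean M x) (x i - ens_mean M x))
    = (\<Sum>i=1..M. outer (u i) (u i) - outer (u i) d - outer d (u i) + outer d d)"
    unfolding shift by (simp add: outer.diff_left outer.diff_right algebra_simps)
  also have "\<dots> = (\<Sum>i=1..M. outer (u i) (u i))
      - outer (\<Sum>i=1..M. u i) d - outer d (\<Sum>i=1..M. u i) + real M *\<^sub>R outer d d"
    by (simp add: sum.distrib sum_subtractf outer.sum_left outer.sum_right sum_constant_scaleR
        del: sum_constant)
  also have "\<dots> = real M *\<^sub>R ((1 / real M) *\<^sub>R (\<Sum>i=1..M. outer (u i) (u i)) - outer d d)"
    unfolding s using M by (simp add: outer.scaleR_left outer.scaleR_right scaleR_diff_right)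
  finally show ?thesis unfolding ens_cov_def d_def u_def by simp
qed

lemma norm_ens_mean_diff_le:
  "norm (ens_mean M x - m) \<le> (\<Sum>i=1..M. norm (x i - z i)) / real M + norm (ens_mean M z - m)"
proof -
  have "ens_mean M x - m = (1 / real M) *\<^sub>R (\<Sum>i=1..M. x i - z i) + (ens_mean M z - m)"
    by (simp add: ens_mean_def sum_subtractf scaleR_diff_right)
  also have "norm \<dots> \<le> norm ((1 / real M) *\<^sub>R (\<Sum>i=1..M. x i - z i)) + norm (ens_mean M z - m)"
    by (rule norm_triangle_ineq)
  also have "norm ((1 / real M) *\<^sub>R (\<Sum>i=1..M. x i - z i)) \<le> (\<Sum>i=1..M. norm (x i - z i)) / real M"
    by (simp add: divide_right_mono norm_sum)
  finally show ?thesis by simp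
qed

lemma norm_outer_diff_le:
  "norm (outer u u - outer v v) \<le> norm (u - v) * (norm (u - v) + 2 * norm v)"
proof -
  have "outer u u - outer v v = outer (u - v) u + outer v (u - v)"
    by (simp add: outer.diff_left outer.diff_right)
  also have "norm \<dots> \<le> norm (u - v) * norm u + norm v * norm (u - v)"
    by (intro norm_triangle_le) (simp add: norm_outer)
  also have "\<dots> \<le> norm (u - v) * (norm (u - v) + norm v) + norm v * norm (u - v)"
    using norm_triangle_sub[of u v] by (intro add_mono mult_left_mono) auto
  finally show ?thesis by (simp add: algebra_simps)
qed

text \<open>The four terms are the sampling fluctuation of the copies, the replacement of copies z
  by particles x, the error of the mean, and the effect of normalising by M - 1. The factor 2 bounds
  M / (M - 1).\<close>

lemma norm_ens_cov_diff_le: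
  assumes M: "2 \<le> M"
  shows "norm (ens_cov M x - P) \<le>
    2 * (norm ((1 / real M) *\<^sub>R (\<Sum>i=1..M. outer (z i - m) (z i - m)) - P)
      + (\<Sum>i=1..M. norm (x i - z i) * (norm (x i - z i) + 2 * norm (z i - m))) / real M
      + (norm (ens_mean M x - m))\<^sup>2 + norm P / real M)"
proof -
  define f where "f = real M / (real M - 1)"
  define d where "d = ens_mean M x - m"
  define Ax Az where "Ax = (1 / real M) *\<^sub>R (\<Sum>i=1..M. outer (x i - m) (x i - m))"
    and "Az = (1 / real M) *\<^sub>R (\<Sum>i=1..M. outer (z i - m) (z i - m))"
  have f: "0 \<le> f" "f \<le> 2" using M by (auto simp: f_def field_simps)
  \<comment> \<open>Turns the excess of the normalising factor over 1 into the term P / M.\<close>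
  have f1: "f - 1 = f / real M" using M by (simp add: f_def field_simps)
  have "ens_cov M x - P = f *\<^sub>R ((Az - P) + (Ax - Az) - outer d d + (1 / real M) *\<^sub>R P)"
  proof -
    have "f *\<^sub>R (1 / real M) *\<^sub>R P = f *\<^sub>R P - P"
      using arg_cong[OF f1, of "\<lambda>r. r *\<^sub>R P"] by (simp add: scaleR_diff_left)
    moreover have "ens_cov M x = f *\<^sub>R (Ax - outer d d)"
      unfolding f_def Ax_def d_def by (rule ens_cov_eq[OF M])
    ultimately show ?thesis by (simp add: scaleR_diff_right scaleR_add_right)
  qed
  then have "norm (ens_cov M x - P) = f * norm ((Az - P) + (Ax - Az) - outer d d + (1 / real M) *\<^sub>R P)"
    using f by simp
  also have "\<dots> \<le> 2 * (norm (Az - P) + norm (Ax - Az) + norm (outer d d) + norm ((1 / real M) *\<^sub>R P))"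
  proof (intro mult_mono f)
    show "norm ((Az - P) + (Ax - Az) - outer d d + (1 / real M) *\<^sub>R P)
      \<le> norm (Az - P) + norm (Ax - Az) + norm (outer d d) + norm ((1 / real M) *\<^sub>R P)"
      using norm_triangle_ineq[of "(Az - P) + (Ax - Az) - outer d d" "(1 / real M) *\<^sub>R P"]
        norm_triangle_ineq4[of "(Az - P) + (Ax - Az)" "outer d d"]
        norm_triangle_ineq[of "Az - P" "Ax - Az"] by linarith
  qed auto
  also have "norm (outer d d) = (norm d)\<^sup>2" by (simp add: norm_outer power2_eq_square)
  also have "norm ((1 / real M) *\<^sub>R P) = norm P / real M" by simp
  also have "norm (Ax - Az)
      \<le> (\<Sum>i=1..M. norm (x i - z i) * (norm (x i - z i) + 2 * norm (z i - m))) / real M"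
  proof -
    have "Ax - Az = (1 / real M) *\<^sub>R
        (\<Sum>i=1..M. outer (x i - m) (x i - m) - outer (z i - m) (z i - m))"
      by (simp add: Ax_def Az_def sum_subtractf scaleR_diff_right)
    then have "norm (Ax - Az)
        = norm (\<Sum>i=1..M. outer (x i - m) (x i - m) - outer (z i - m) (z i - m)) / real M" by simp
    also have "norm (\<Sum>i=1..M. outer (x i - m) (x i - m) - outer (z i - m) (z i - m))
        \<le> (\<Sum>i=1..M. norm (x i - z i) * (norm (x i - z i) + 2 * norm (z i - m)))"
    proof (rule sum_norm_le)
      show "norm (outer (x i - m) (x i - m) - outer (z i - m) (z i - m))
        \<le> norm (x i - z i) * (norm (x i - z i) + 2 * norm (z i - m))" for i
        using norm_outer_diff_le[of "x i - m" "z i - m"] by simp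
    qed
    finally show ?thesis by (simp add: divide_right_mono)
  qed
  finally show ?thesis by (simp add: Az_def d_def)
qed

subsection \<open>Gaussian moments, independence and laws\<close>

text \<open>Lebesgue measure is a product over the standard basis and so is the integrand; the
  integral factors into one-dimensional normal moments.\<close>

lemma nn_integral_std_gaussian_coordinate_moment:
  fixes j :: "'n::finite"
  shows "(\<integral>\<^sup>+x. ennreal (\<Prod>i\<in>UNIV. std_normal_density (x $ i)) * ennreal (\<bar>x $ j\<bar> ^ n)
    \<partial>(lborel :: (real ^ 'n) measure)) < \<infinity>"
proof -
  have basis: "(Basis :: (real ^ 'n) set) = range (\<lambda>i. axis i 1)"
    by (auto simp: Basis_vec_def)
  have inj: "inj (\<lambda>i :: 'n. axis i (1::real))" by (auto simp: inj_def axis_eq_axis)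
  \<comment> \<open>All coordinates get the same form of factor: exponent n in direction j and
    exponent 0 elsewhere, so one moment lemma handles both.\<close>
  define f :: "real ^ 'n \<Rightarrow> real \<Rightarrow> ennreal" where
    "f = (\<lambda>b t. ennreal (std_normal_density t * \<bar>t\<bar> ^ (if b = axis j 1 then n else 0)))"
  have prod_f: "(\<Prod>b\<in>Basis. f b (x \<bullet> b))
      = ennreal (\<Prod>i\<in>UNIV. std_normal_density (x $ i)) * ennreal (\<bar>x $ j\<bar> ^ n)" for x
  proof -
    have "(\<Prod>b\<in>Basis. f b (x \<bullet> b)) = (\<Prod>i\<in>UNIV. f (axis i 1) (x $ i))"
      unfolding basis by (subst prod.reindex[OF inj]) (simp add: cart_eq_inner_axis[symmetric])
    also have "\<dots> = (\<Prod>i\<in>UNIV. ennreal (std_normal_density (x $ i) * (if i = j then \<bar>x $ j\<bar> ^ n else 1)))"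
      by (intro prod.cong) (auto simp: f_def axis_eq_axis)
    also have "\<dots> = ennreal (\<Prod>i\<in>UNIV. std_normal_density (x $ i) * (if i = j then \<bar>x $ j\<bar> ^ n else 1))"
      by (rule prod_ennreal) simp
    also have "\<dots> = ennreal ((\<Prod>i\<in>UNIV. std_normal_density (x $ i)) * \<bar>x $ j\<bar> ^ n)"
      by (simp add: prod.distrib)
    finally show ?thesis by (simp add: ennreal_mult prod_nonneg)
  qed
  have "(\<integral>\<^sup>+x. (\<Prod>b\<in>Basis. f b (x \<bullet> b)) \<partial>lborel) = (\<Prod>b\<in>Basis. (\<integral>\<^sup>+t. f b t \<partial>lborel))"
    by (rule nn_integral_lborel_prod) (auto simp: f_def)
  also have "\<dots> < \<infinity>"
  proof -
    have prod_finite: "prod g S < \<infinity>" if "\<And>b. b \<in> S \<Longrightarrow> g b < \<infinity>" for g :: "real ^ 'n \<Rightarrow> ennreal" and S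
      using that by (induction S rule: infinite_finite_induct) (auto simp: ennreal_mult_less_top)
    have "(\<integral>\<^sup>+t. f b t \<partial>lborel) < \<infinity>" for b
      unfolding f_def
      by (subst nn_integral_eq_integral[OF integrable_std_normal_moment_abs]) auto
    then show ?thesis by (intro prod_finite)
  qed
  finally show ?thesis by (simp add: prod_f)
qed

context prob_space
begin

text \<open>Grouping principle: quantities built from disjoint blocks of independent sources are
  independent. It is phrased with event families instead of random variables because the sources,
  initial conditions and noise, have different types.\<close>

lemma indep_vars_blocks:
  fixes Z :: "'j \<Rightarrow> 'a \<Rightarrow> 'b::topological_space"
  assumes indep: "indep_sets G K" and stable: "\<And>k. k \<in> K \<Longrightarrow> Int_stable (G k)"
    and sub: "\<And>j. j \<in> J \<Longrightarrow> blk j \<subseteq> K" and disj: "disjoint_family_on blk J"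
    and Z: "\<And>j. j \<in> J \<Longrightarrow> Z j \<in> borel_measurable (sigma (space M) (\<Union>k\<in>blk j. G k))"
  shows "indep_vars (\<lambda>_. borel) Z J"
proof -
  have G: "G k \<subseteq> events" if "k \<in> K" for k using indep that by (auto simp: indep_sets_def)
  have pre: "Z j -` A \<inter> space M \<in> sigma_sets (space M) (\<Union>k\<in>blk j. G k)"
    if "j \<in> J" "A \<in> sets borel" for j A
  proof -
    have "(\<Union>k\<in>blk j. G k) \<subseteq> Pow (space M)"
      using G sub[OF that(1)] sets.sets_into_space by blast
    then show ?thesis
      using measurable_sets[OF Z[OF that(1)] that(2)]
      by (simp add: space_measure_of_conv sets_measure_of)
  qed
  have "sigma_sets (space M) (\<Union>k\<in>blk j. G k) \<subseteq> events" if "j \<in> J" for j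
    using G sub[OF that] by (intro sets.sigma_sets_subset) blast
  then have "random_variable borel (Z j)" if "j \<in> J" for j
    using pre that by (intro measurableI) auto
  moreover have "indep_sets (\<lambda>j. sigma_sets (space M) (\<Union>k\<in>blk j. G k)) J"
  proof (rule indep_sets_collect_sigma[OF _ _ disj])
    show "indep_sets G (\<Union>j\<in>J. blk j)"
      by (rule indep_sets_mono_index[OF _ indep]) (use sub in auto)
    show "Int_stable (G k)" if "j \<in> J" "k \<in> blk j" for k j using stable sub that by blast
  qed
  then have "indep_sets (\<lambda>j. {Z j -` A \<inter> space M |A. A \<in> sets borel}) J"
    by (rule indep_sets_mono_sets) (use pre in auto)
  ultimately show ?thesis by (simp add: indep_vars_def2)
qed

lemma moment_bounded_standard_gaussian:
  fixes G :: "'i \<Rightarrow> 'a \<Rightarrow> real ^ 'n"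
  assumes G: "\<And>i. i \<in> I \<Longrightarrow> standard_gaussian M (G i)"
  shows "moment_bounded M I (\<lambda>i \<omega>. norm (G i \<omega>))"
proof -
  have meas: "G i \<in> borel_measurable M" if "i \<in> I" for i
    using G[OF that] unfolding standard_gaussian_def distributed_def by simp
  have coord: "moment_bounded M I (\<lambda>i \<omega>. \<bar>G i \<omega> $ j\<bar>)" for j
  proof (rule moment_boundedI[where V = "\<lambda>i \<omega>. \<bar>G i \<omega> $ j\<bar>"])
    show "(\<lambda>\<omega>. \<bar>G i \<omega> $ j\<bar>) \<in> borel_measurable M" if "i \<in> I" for i
      using borel_measurable_inner[OF meas[OF that] borel_measurable_const[of "axis j 1"]]
      by (simp add: cart_eq_inner_axis[symmetric])
    fix n
    let ?c = "\<integral>\<^sup>+x. ennreal (\<Prod>i\<in>UNIV. std_normal_density (x $ i)) * ennreal (\<bar>x $ j\<bar> ^ n)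
      \<partial>(lborel :: (real ^ 'n) measure)"
    have "(\<integral>\<^sup>+\<omega>. ennreal (\<bar>G i \<omega> $ j\<bar> ^ n) \<partial>M) = ?c" if "i \<in> I" for i
      using distributed_nn_integral[OF G[OF that, unfolded standard_gaussian_def],
          of "\<lambda>x. ennreal (\<bar>x $ j\<bar> ^ n)"]
      by simp
    then show "\<exists>c. \<forall>i\<in>I. (\<integral>\<^sup>+\<omega>. ennreal (\<bar>G i \<omega> $ j\<bar> ^ n) \<partial>M) \<le> ennreal c"
      using nn_integral_std_gaussian_coordinate_moment[of j n]
      by (intro exI[of _ "enn2real ?c"]) simp
  qed simp
  have "moment_bounded M I (\<lambda>i \<omega>. \<Sum>j\<in>UNIV. \<bar>G i \<omega> $ j\<bar>)"
    by (intro moment_bounded_sum coord)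
  then show ?thesis by (rule moment_bounded_mono) (simp add: norm_le_l1_cart)
qed

lemma moment_bounded_of_law:
  fixes X :: "'i \<Rightarrow> 'a \<Rightarrow> 'b::{second_countable_topology, real_normed_vector}"
  assumes meas: "\<And>i. i \<in> I \<Longrightarrow> X i \<in> borel_measurable M"
    and law: "\<And>i. i \<in> I \<Longrightarrow> distr M borel (X i) = \<pi>"
    and mom: "\<And>p::real. p \<ge> 2 \<Longrightarrow> integrable \<pi> (\<lambda>x. norm x powr p)"
  shows "moment_bounded M I (\<lambda>i \<omega>. norm (X i \<omega>))"
proof (rule moment_boundedI[where V = "\<lambda>i \<omega>. norm (X i \<omega>)"])
  fix n :: nat
  \<comment> \<open>The shift by 2 keeps the exponent in the range p >= 2 of the hypothesis, also
    for n = 0 and n = 1.\<close>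
  let ?c = "\<integral>\<^sup>+x. ennreal (norm x powr (n + 2)) \<partial>\<pi>"
  have fin: "?c < \<infinity>" using mom[of "n + 2"] by (simp add: integrable_iff_bounded)
  have "(\<integral>\<^sup>+\<omega>. ennreal (norm (X i \<omega>) ^ n) \<partial>M) \<le> ennreal (1 + enn2real ?c)" if i: "i \<in> I" for i
  proof -
    note [measurable] = meas[OF i]
    have "(\<integral>\<^sup>+\<omega>. ennreal (norm (X i \<omega>) ^ n) \<partial>M)
        \<le> (\<integral>\<^sup>+\<omega>. 1 + ennreal (norm (X i \<omega>) powr (n + 2)) \<partial>M)"
    proof (rule nn_integral_mono)
      fix \<omega>
      have "norm (X i \<omega>) ^ n \<le> 1 + norm (X i \<omega>) ^ (n + 2)"
        by (rule power_le_one_plus_power) auto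
      \<comment> \<open>At 0 the two powers agree because the exponent is positive.\<close>
      also have "norm (X i \<omega>) ^ (n + 2) = norm (X i \<omega>) powr (n + 2)"
        using powr_realpow[of "norm (X i \<omega>)" "n + 2"] by (cases "X i \<omega> = 0") simp_all
      finally show "ennreal (norm (X i \<omega>) ^ n) \<le> 1 + ennreal (norm (X i \<omega>) powr (n + 2))"
        by (simp add: ennreal_leI flip: ennreal_1 ennreal_plus)
    qed
    also have "\<dots> = 1 + (\<integral>\<^sup>+\<omega>. ennreal (norm (X i \<omega>) powr (n + 2)) \<partial>M)"
      by (simp add: nn_integral_add emeasure_space_1)
    also have "(\<integral>\<^sup>+\<omega>. ennreal (norm (X i \<omega>) powr (n + 2)) \<partial>M) = ?c"
      unfolding law[OF i, symmetric] by (simp add: nn_integral_distr)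
    also have "1 + ?c = ennreal (1 + enn2real ?c)" using fin by (simp add: ennreal_plus)
    finally show ?thesis .
  qed
  then show "\<exists>c. \<forall>i\<in>I. (\<integral>\<^sup>+\<omega>. ennreal (norm (X i \<omega>) ^ n) \<partial>M) \<le> ennreal c" by blast
qed (use meas in auto)

text \<open>Under independence the law of a sum is the image of the product of the marginal laws, so
  it depends on these alone.\<close>

lemma distr_add_cong:
  fixes X :: "'a \<Rightarrow> 'b::euclidean_space"
  assumes ind: "indep_var borel X borel U" "indep_var borel X' borel U'"
    and law: "distr M borel X = distr M borel X'" "distr M borel U = distr M borel U'"
  shows "distr M borel (\<lambda>\<omega>. X \<omega> + U \<omega>) = distr M borel (\<lambda>\<omega>. X' \<omega> + U' \<omega>)"
proof -
  have *: "distr M borel (\<lambda>\<omega>. X \<omega> + U \<omega>)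
      = distr (distr M borel X \<Otimes>\<^sub>M distr M borel U) borel (\<lambda>(x, u). x + u)"
    if "indep_var borel X borel U" for X U :: "'a \<Rightarrow> 'b"
  proof -
    have [measurable]: "X \<in> borel_measurable M" "U \<in> borel_measurable M"
      and prod: "distr M borel X \<Otimes>\<^sub>M distr M borel U = distr M (borel \<Otimes>\<^sub>M borel) (\<lambda>\<omega>. (X \<omega>, U \<omega>))"
      using that unfolding indep_var_distribution_eq by auto
    show ?thesis unfolding prod by (subst distr_distr) (auto simp: o_def)
  qed
  show ?thesis by (simp only: *[OF ind(1)] *[OF ind(2)] law)
qed

end

text \<open>The recursion takes mean and covariance of a random variable, and distinct copies agree
  only in law; both quantities are integrals against that law.\<close>

lemma law_mean_cov_cong:
  fixes X X' :: "'w \<Rightarrow> real ^ 'd"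
  assumes [measurable]: "X \<in> borel_measurable \<P>" "X' \<in> borel_measurable \<P>"
    and law: "distr \<P> borel X = distr \<P> borel X'"
  shows "law_mean \<P> X = law_mean \<P> X'" "law_cov \<P> X = law_cov \<P> X'"
proof -
  have mean: "law_mean \<P> X = (\<integral>x. x \<partial>distr \<P> borel X)" if "X \<in> borel_measurable \<P>" for X :: "'w \<Rightarrow> real ^ 'd"
    unfolding law_mean_def by (subst integral_distr) (use that in auto)
  show eq: "law_mean \<P> X = law_mean \<P> X'"
    unfolding mean[OF assms(1)] mean[OF assms(2)] law ..
  have [measurable]: "(\<lambda>x. outer (x - m) (x - m)) \<in> borel_measurable borel" for m :: "real ^ 'd"
    by (intro borel_measurable_continuous_onI outer.continuous_on continuous_intros)
  have cov: "law_cov \<P> X = (\<integral>x. outer (x - law_mean \<P> X) (x - law_mean \<P> X) \<partial>distr \<P> borel X)"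
    if "X \<in> borel_measurable \<P>" for X :: "'w \<Rightarrow> real ^ 'd"
    unfolding law_cov_def by (subst integral_distr) (use that in auto)
  show "law_cov \<P> X = law_cov \<P> X'"
    unfolding cov[OF assms(1)] cov[OF assms(2)] eq law ..
qed

subsection \<open>The mean-field copies\<close>

locale filter_model = prob_space M for M :: "'w measure" +
  fixes B :: "real ^ 'd \<Rightarrow> real ^ 'd" and C :: "real ^ 'r ^ 'd" and H :: "real ^ 'd ^ 'q"
    and R :: "real ^ 'q ^ 'q" and T :: "real ^ 'd ^ 'd \<Rightarrow> real ^ 'd ^ 'd"
    and Y :: "nat \<Rightarrow> real ^ 'q" and L L\<^sub>T :: real and \<pi>\<^sub>0 :: "(real ^ 'd) measure"
    and X0 :: "nat \<Rightarrow> 'w \<Rightarrow> real ^ 'd" and W :: "nat \<Rightarrow> nat \<Rightarrow> 'w \<Rightarrow> real ^ 'r"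
  assumes B_Lipschitz: "L-lipschitz_on UNIV B"
    and R_pos_def: "pos_def R"
    and L\<^sub>T_pos: "L\<^sub>T > 0"
    and T_Lipschitz: "\<And>P P'. pos_semidef P \<Longrightarrow> pos_semidef P' \<Longrightarrow>
               spectral_norm (T P - T P')
                 \<le> L\<^sub>T * (1 + (spectral_norm P)\<^sup>2 + (spectral_norm P')\<^sup>2) * spectral_norm (P - P')"
    and indep: "jointly_independent M X0 {1..} (\<lambda>(k, i). W k i) ({1..} \<times> {1..})"
    and X0_law: "\<And>i. i \<ge> 1 \<Longrightarrow> distr M borel (X0 i) = \<pi>\<^sub>0"
    and W_law: "\<And>k i. k \<ge> 1 \<Longrightarrow> i \<ge> 1 \<Longrightarrow> standard_gaussian M (W k i)"
    and moments: "\<And>p::real. p \<ge> 2 \<Longrightarrow> integrable \<pi>\<^sub>0 (\<lambda>x. norm x powr p)"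
begin

text \<open>Copy i uses the means and covariances of its own forecasts. Their independence of i is a
  consequence of equality in law, shown below.\<close>

definition copy_a :: "nat \<Rightarrow> nat \<Rightarrow> 'w \<Rightarrow> real ^ 'd" where
  "copy_a k i = mean_field_a M B C H R T Y (X0 i) (\<lambda>l. W l i) k"

definition copy_f :: "nat \<Rightarrow> nat \<Rightarrow> 'w \<Rightarrow> real ^ 'd" where
  "copy_f k i = mean_field_f M B C H R T Y (X0 i) (\<lambda>l. W l i) k"

lemma copy_a_0: "copy_a 0 i = X0 i"
  by (simp add: copy_a_def)

lemma copy_f_Suc: "copy_f (Suc k) i \<omega> = B (copy_a k i \<omega>) + C *v W (Suc k) i \<omega>"
  by (simp add: copy_f_def copy_a_def mean_field_f_def forecast_map_def)

lemma copy_a_Suc: "copy_a (Suc k) i \<omega> =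
    analysis_map H R T (Y (Suc k)) (law_mean M (copy_f (Suc k) i)) (law_cov M (copy_f (Suc k) i)) (copy_f (Suc k) i \<omega>)"
proof -
  have "copy_f (Suc k) i = (\<lambda>\<omega>. forecast_map B C (copy_a k i \<omega>) (W (Suc k) i \<omega>))"
    by (simp add: copy_f_Suc forecast_map_def fun_eq_iff)
  then show ?thesis by (simp add: copy_a_def Let_def)
qed

lemma B_measurable [measurable]: "B \<in> borel_measurable borel"
  by (intro borel_measurable_continuous_onI lipschitz_on_continuous_on[OF B_Lipschitz])

lemma matrix_mult_measurable [measurable]: "(\<lambda>x. A *v x) \<in> borel_measurable borel"
  for A :: "real ^ 'n ^ 'm"
  by (intro borel_measurable_continuous_onI matrix_vector_mult_linear_continuous_on)

lemma analysis_map_measurable [measurable]: "analysis_map H R T y m P \<in> borel_measurable borel"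
proof -
  have "(\<lambda>x. (m + kalman_gain H R P *v (y - H *v m)) + T P *v (x - m)) \<in> borel_measurable borel"
    by measurable
  then show ?thesis by (simp add: analysis_map_def[abs_def])
qed

text \<open>The measure \<open>N\<close> is left free so that the statement serves the full
  sigma-algebra as well as the one generated by the history of a copy. Means and covariances are
  always taken under \<open>M\<close> and enter as constants.\<close>

lemma mean_field_measurable:
  assumes X0: "X0 i \<in> borel_measurable N"
    and W: "\<And>l. 1 \<le> l \<Longrightarrow> l \<le> k \<Longrightarrow> W l i \<in> borel_measurable N"
  shows "l \<le> k \<Longrightarrow> copy_a l i \<in> borel_measurable N"
    and "1 \<le> l \<Longrightarrow> l \<le> k \<Longrightarrow> copy_f l i \<in> borel_measurable N"
proof -
  have step: "copy_f (Suc l) i \<in> borel_measurable N"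
    if "copy_a l i \<in> borel_measurable N" "Suc l \<le> k" for l
  proof -
    have [measurable]: "copy_a l i \<in> borel_measurable N" "W (Suc l) i \<in> borel_measurable N"
      using that W by auto
    show ?thesis by (subst copy_f_Suc[abs_def]) measurable
  qed
  have a: "copy_a l i \<in> borel_measurable N" if "l \<le> k" for l
    using that
  proof (induction l)
    case 0
    then show ?case using X0 by (simp add: copy_a_0)
  next
    case (Suc l)
    then have [measurable]: "copy_f (Suc l) i \<in> borel_measurable N" by (intro step) auto
    show ?case by (subst copy_a_Suc[abs_def]) measurable
  qed
  then show "l \<le> k \<Longrightarrow> copy_a l i \<in> borel_measurable N" .
  show "1 \<le> l \<Longrightarrow> l \<le> k \<Longrightarrow> copy_f l i \<in> borel_measurable N"
    using step[OF a] by (cases l) auto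
qed

section \<open>Noise histories and independence of the copies\<close>

definition driving_events :: "nat + nat \<times> nat \<Rightarrow> 'w set set" where
  "driving_events = case_sum (\<lambda>i. generated_events M (X0 i)) (\<lambda>(k, i). generated_events M (W k i))"

text \<open>The sources that copy i has seen up to time k. These sets are disjoint for distinct i,
  and the noise of time k + 1 lies outside.\<close>

definition history :: "nat \<Rightarrow> nat \<Rightarrow> (nat + nat \<times> nat) set" where
  "history k i = insert (Inl i) (Inr ` ({1..k} \<times> {i}))"

lemma driving_indep: "indep_sets driving_events ({1..} <+> {1..} \<times> {1..})"
  and X0_meas: "i \<ge> 1 \<Longrightarrow> X0 i \<in> borel_measurable M"
  and W_meas: "k \<ge> 1 \<Longrightarrow> i \<ge> 1 \<Longrightarrow> W k i \<in> borel_measurable M"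
proof -
  have "driving_events = case_sum (\<lambda>i. generated_events M (X0 i)) (\<lambda>j. generated_events M ((\<lambda>(k, i). W k i) j))"
    by (auto simp: driving_events_def fun_eq_iff split: sum.split)
  then show "indep_sets driving_events ({1..} <+> {1..} \<times> {1..})"
    using indep unfolding jointly_independent_def by simp
  show "i \<ge> 1 \<Longrightarrow> X0 i \<in> borel_measurable M" "k \<ge> 1 \<Longrightarrow> i \<ge> 1 \<Longrightarrow> W k i \<in> borel_measurable M"
    using indep unfolding jointly_independent_def by auto
qed

lemma Int_stable_generated_events: "Int_stable (generated_events \<P> X)"
proof (rule Int_stableI)
  fix a b assume "a \<in> generated_events \<P> X" "b \<in> generated_events \<P> X"
  then obtain A A' where "A \<in> sets borel" "A' \<in> sets borel"
    "a = X -` A \<inter> space \<P>" "b = X -` A' \<inter> space \<P>"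
    by (auto simp: generated_events_def)
  then show "a \<inter> b \<in> generated_events \<P> X"
    unfolding generated_events_def by (intro CollectI exI[of _ "A \<inter> A'"]) auto
qed

lemma Int_stable_driving_events: "Int_stable (driving_events j)"
  by (auto simp: driving_events_def Int_stable_generated_events split: sum.split prod.split)

lemma measurable_generated:
  fixes X :: "'w \<Rightarrow> 'c::topological_space"
  assumes "generated_events M X \<subseteq> (\<Union>j\<in>J. driving_events j)"
  shows "X \<in> borel_measurable (sigma (space M) (\<Union>j\<in>J. driving_events j))"
proof (rule measurableI)
  have "driving_events j \<subseteq> Pow (space M)" for j
    by (cases j) (auto simp: driving_events_def generated_events_def)
  then have "(\<Union>j\<in>J. driving_events j) \<subseteq> Pow (space M)" by blast
  moreover fix A :: "'c set" assume "A \<in> sets borel"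
  then have "X -` A \<inter> space M \<in> (\<Union>j\<in>J. driving_events j)"
    using assms by (auto simp: generated_events_def)
  ultimately show "X -` A \<inter> space (sigma (space M) (\<Union>j\<in>J. driving_events j))
      \<in> sets (sigma (space M) (\<Union>j\<in>J. driving_events j))"
    by (simp add: space_measure_of_conv sets_measure_of sigma_sets.Basic)
qed simp

lemma history_measurable:
  shows "l \<le> k \<Longrightarrow> copy_a l i \<in> borel_measurable (sigma (space M) (\<Union>j\<in>history k i. driving_events j))"
    and "1 \<le> l \<Longrightarrow> l \<le> k \<Longrightarrow>
      copy_f l i \<in> borel_measurable (sigma (space M) (\<Union>j\<in>history k i. driving_events j))"
proof -
  have X: "X0 i \<in> borel_measurable (sigma (space M) (\<Union>j\<in>history k i. driving_events j))"
    by (rule measurable_generated) (auto simp: history_def driving_events_def)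
  have W: "W l i \<in> borel_measurable (sigma (space M) (\<Union>j\<in>history k i. driving_events j))"
    if "1 \<le> l" "l \<le> k" for l
    by (rule measurable_generated) (use that in \<open>force simp: history_def driving_events_def\<close>)
  show "l \<le> k \<Longrightarrow> copy_a l i \<in> borel_measurable (sigma (space M) (\<Union>j\<in>history k i. driving_events j))"
    and "1 \<le> l \<Longrightarrow> l \<le> k \<Longrightarrow>
      copy_f l i \<in> borel_measurable (sigma (space M) (\<Union>j\<in>history k i. driving_events j))"
    by (rule mean_field_measurable[OF X W]; assumption)+
qed

lemma copy_a_meas: "i \<ge> 1 \<Longrightarrow> copy_a k i \<in> borel_measurable M"
  by (rule mean_field_measurable(1)[OF X0_meas W_meas order_refl]) auto

lemma copy_f_meas: "k \<ge> 1 \<Longrightarrow> i \<ge> 1 \<Longrightarrow> copy_f k i \<in> borel_measurable M"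
  by (rule mean_field_measurable(2)[OF X0_meas W_meas _ order_refl]) auto

text \<open>Copies interact with nothing but deterministic laws, so each is a function of its own
  history, and the histories are disjoint blocks.\<close>

lemma copy_f_indep_vars:
  assumes "k \<ge> 1"
  shows "indep_vars (\<lambda>_. borel) (copy_f k) {1..}"
proof (rule indep_vars_blocks[OF driving_indep Int_stable_driving_events])
  show "history k i \<subseteq> {1..} <+> {1..} \<times> {1..}" if "i \<in> {1..}" for i
    using that by (auto simp: history_def)
  show "disjoint_family_on (history k) {1..}"
    by (auto simp: disjoint_family_on_def history_def)
  show "copy_f k i \<in> borel_measurable (sigma (space M) (\<Union>j\<in>history k i. driving_events j))" for i
    using assms by (intro history_measurable) auto
qed

text \<open>The two blocks are the history up to time k and the single source of noise at time k +
  1.\<close>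

lemma forecast_indep:
  assumes i: "i \<ge> 1"
  shows "indep_var borel (\<lambda>\<omega>. B (copy_a k i \<omega>)) borel (\<lambda>\<omega>. C *v W (Suc k) i \<omega>)"
proof -
  have "indep_vars (\<lambda>_. borel)
    (case_bool (\<lambda>\<omega>. B (copy_a k i \<omega>)) (\<lambda>\<omega>. C *v W (Suc k) i \<omega>)) UNIV"
  proof (rule indep_vars_blocks[OF driving_indep Int_stable_driving_events,
        where blk = "case_bool (history k i) {Inr (Suc k, i)}"])
    show "(case b of True \<Rightarrow> history k i | False \<Rightarrow> {Inr (Suc k, i)}) \<subseteq> {1..} <+> {1..} \<times> {1..}" for b
      using i by (auto simp: history_def split: bool.split)
    show "disjoint_family_on (case_bool (history k i) {Inr (Suc k, i)}) UNIV"
      by (auto simp: disjoint_family_on_def history_def split: bool.splits)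
    have "W (Suc k) i \<in> borel_measurable (sigma (space M) (\<Union>j\<in>{Inr (Suc k, i)}. driving_events j))"
      by (rule measurable_generated) (auto simp: driving_events_def)
    moreover note history_measurable(1)[OF order_refl, of k i]
    ultimately show "(case b of True \<Rightarrow> \<lambda>\<omega>. B (copy_a k i \<omega>) | False \<Rightarrow> \<lambda>\<omega>. C *v W (Suc k) i \<omega>)
      \<in> borel_measurable (sigma (space M)
          (\<Union>j\<in>(case b of True \<Rightarrow> history k i | False \<Rightarrow> {Inr (Suc k, i)}). driving_events j))" for b
      by (cases b) (auto intro: measurable_compose[OF _ B_measurable] measurable_compose[OF _ matrix_mult_measurable])
  qed
  moreover have "(\<lambda>_. borel) = case_bool borel borel" by (auto simp: fun_eq_iff split: bool.split)
  ultimately show ?thesis unfolding indep_var_def by metis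
qed

section \<open>Common law and moments of the copies\<close>

lemma distr_compose_cong:
  assumes "X \<in> borel_measurable M" "X' \<in> borel_measurable M" "g \<in> borel_measurable borel"
    and "distr M borel X = distr M borel X'"
  shows "distr M borel (\<lambda>\<omega>. g (X \<omega>)) = distr M borel (\<lambda>\<omega>. g (X' \<omega>))"
  using assms distr_distr[of g borel borel X M] distr_distr[of g borel borel X' M]
  by (simp add: o_def)

lemma W_same_law:
  assumes "k \<ge> 1" "i \<ge> 1" "j \<ge> 1"
  shows "distr M borel (W k i) = distr M borel (W k j)"
proof -
  have "distr M borel (W k i) = density lborel (\<lambda>x. ennreal (\<Prod>i\<in>UNIV. std_normal_density (x $ i)))"
    if "i \<ge> 1" for i
    using distributed_distr_eq_density[OF W_law[OF assms(1) that, unfolded standard_gaussian_def]]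
    by (metis (no_types, lifting) distr_cong sets_lborel)
  then show ?thesis using assms by simp
qed

text \<open>Induction over time. The forecast adds independent noise to a function of the state,
  which determines its law; the analysis then applies a map whose mean and covariance parameters
  depend on that law only and hence is the same for i and 1.\<close>

lemma mean_field_same_law:
  assumes i: "i \<ge> 1"
  shows "distr M borel (copy_a k i) = distr M borel (copy_a k 1)"
    and "distr M borel (copy_f (Suc k) i) = distr M borel (copy_f (Suc k) 1)"
proof -
  have step: "distr M borel (copy_f (Suc k) i) = distr M borel (copy_f (Suc k) 1)"
    if "distr M borel (copy_a k i) = distr M borel (copy_a k 1)" for k
    unfolding copy_f_Suc[abs_def]
  proof (rule distr_add_cong[OF forecast_indep[OF i] forecast_indep])
    show "distr M borel (\<lambda>\<omega>. B (copy_a k i \<omega>)) = distr M borel (\<lambda>\<omega>. B (copy_a k 1 \<omega>))"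
      by (rule distr_compose_cong) (use i copy_a_meas that in auto)
    show "distr M borel (\<lambda>\<omega>. C *v W (Suc k) i \<omega>) = distr M borel (\<lambda>\<omega>. C *v W (Suc k) 1 \<omega>)"
      by (rule distr_compose_cong[OF W_meas W_meas matrix_mult_measurable W_same_law]) (use i in auto)
  qed simp
  have a: "distr M borel (copy_a k i) = distr M borel (copy_a k 1)" for k
  proof (induction k)
    case 0
    then show ?case using X0_law i by (simp add: copy_a_0)
  next
    case (Suc k)
    have z: "copy_f (Suc k) i \<in> borel_measurable M" "copy_f (Suc k) 1 \<in> borel_measurable M"
      using copy_f_meas i by auto
    show ?case
      unfolding copy_a_Suc[abs_def] law_mean_cov_cong[OF z step[OF Suc]]
      by (rule distr_compose_cong[OF z analysis_map_measurable step[OF Suc]])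
  qed
  show "distr M borel (copy_a k i) = distr M borel (copy_a k 1)" by (rule a)
  show "distr M borel (copy_f (Suc k) i) = distr M borel (copy_f (Suc k) 1)" by (rule step[OF a])
qed

text \<open>Copy 1 serves as representative of all copies.\<close>

definition fmean :: "nat \<Rightarrow> real ^ 'd" where
  "fmean k = law_mean M (copy_f k 1)"

definition fcov :: "nat \<Rightarrow> real ^ 'd ^ 'd" where
  "fcov k = law_cov M (copy_f k 1)"

lemma mean_field_mean_cov:
  assumes "k \<ge> 1" "i \<ge> 1"
  shows "law_mean M (copy_f k i) = fmean k" "law_cov M (copy_f k i) = fcov k"
proof -
  obtain l where k: "k = Suc l" using assms(1) by (cases k) auto
  have "copy_f k i \<in> borel_measurable M" "copy_f k 1 \<in> borel_measurable M" using assms copy_f_meas by auto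
  moreover have "distr M borel (copy_f k i) = distr M borel (copy_f k 1)"
    unfolding k by (rule mean_field_same_law(2)[OF assms(2)])
  ultimately show "law_mean M (copy_f k i) = fmean k" "law_cov M (copy_f k i) = fcov k"
    unfolding fmean_def fcov_def by (rule law_mean_cov_cong)+
qed

text \<open>A Lipschitz map has linear growth, the noise is Gaussian, and the analysis is affine in
  the forecast with deterministic coefficients; each step preserves finiteness of all
  moments.\<close>

lemma mean_field_moments:
  shows "moment_bounded M {1..} (\<lambda>i \<omega>. norm (copy_a k i \<omega>))"
    and "moment_bounded M {1..} (\<lambda>i \<omega>. norm (copy_f (Suc k) i \<omega>))"
proof -
  have step: "moment_bounded M {1..} (\<lambda>i \<omega>. norm (copy_f (Suc k) i \<omega>))"
    if "moment_bounded M {1..} (\<lambda>i \<omega>. norm (copy_a k i \<omega>))" for k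
  proof (rule moment_bounded_mono)
    show "moment_bounded M {1..} (\<lambda>i \<omega>. (norm (B 0) + L * norm (copy_a k i \<omega>)) + norm C * norm (W (Suc k) i \<omega>))"
      by (intro moment_bounded_add moment_bounded_cmult moment_bounded_const that
          moment_bounded_standard_gaussian) (use W_law in auto)
    fix i \<omega>
    have "norm (B (copy_a k i \<omega>)) \<le> norm (B 0) + L * norm (copy_a k i \<omega>)"
      using lipschitz_onD[OF B_Lipschitz, of "copy_a k i \<omega>" 0] norm_triangle_sub[of "B (copy_a k i \<omega>)" "B 0"]
      by (simp add: dist_norm)
    then show "\<bar>norm (copy_f (Suc k) i \<omega>)\<bar>
      \<le> (norm (B 0) + L * norm (copy_a k i \<omega>)) + norm C * norm (W (Suc k) i \<omega>)"
      unfolding copy_f_Suc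
      using norm_triangle_ineq[of "B (copy_a k i \<omega>)" "C *v W (Suc k) i \<omega>"]
        norm_matrix_vector_mult_le[of C "W (Suc k) i \<omega>"] by simp
  qed
  have a: "moment_bounded M {1..} (\<lambda>i \<omega>. norm (copy_a k i \<omega>))" for k
  proof (induction k)
    case 0
    show ?case unfolding copy_a_0
      by (rule moment_bounded_of_law[OF _ _ moments]) (use X0_law X0_meas in auto)
  next
    case (Suc k)
    define m P v where "m = fmean (Suc k)" and "P = fcov (Suc k)"
      and "v = m + kalman_gain H R P *v (Y (Suc k) - H *v m)"
    show ?case
    proof (rule moment_bounded_mono)
      show "moment_bounded M {1..} (\<lambda>i \<omega>. norm v + norm (T P) * (norm (copy_f (Suc k) i \<omega>) + norm m))"
        by (intro moment_bounded_add moment_bounded_cmult moment_bounded_const step Suc)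
      fix i \<omega> assume "i \<in> {1::nat..}"
      then have eq: "copy_a (Suc k) i \<omega> = v + T P *v (copy_f (Suc k) i \<omega> - m)"
        by (simp add: copy_a_Suc analysis_map_def mean_field_mean_cov m_def P_def v_def)
      have "norm (T P *v (copy_f (Suc k) i \<omega> - m)) \<le> norm (T P) * (norm (copy_f (Suc k) i \<omega>) + norm m)"
        by (intro order_trans[OF norm_matrix_vector_mult_le] mult_left_mono norm_triangle_ineq4) simp
      then show "\<bar>norm (copy_a (Suc k) i \<omega>)\<bar> \<le> norm v + norm (T P) * (norm (copy_f (Suc k) i \<omega>) + norm m)"
        unfolding eq using norm_triangle_ineq[of v "T P *v (copy_f (Suc k) i \<omega> - m)"] by simp
    qed
  qed
  show "moment_bounded M {1..} (\<lambda>i \<omega>. norm (copy_a k i \<omega>))" by (rule a)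
  show "moment_bounded M {1..} (\<lambda>i \<omega>. norm (copy_f (Suc k) i \<omega>))" by (rule step[OF a])
qed

end

subsection \<open>Propagation of the error\<close>

text \<open>Supplies the unscaled factors of a product from the scaled estimates, since sqrt N >=
  1.\<close>

lemma moment_bounded_of_sqrt_multiple:
  assumes "moment_bounded \<P> {2..} (\<lambda>N \<omega>. sqrt (real N) * U N \<omega>)"
    and "\<And>N \<omega>. 0 \<le> U N \<omega>"
  shows "moment_bounded \<P> {2..} U"
  using assms(1)
proof (rule moment_bounded_mono)
  fix N :: nat and \<omega> assume "N \<in> {2..}"
  then have "1 * U N \<omega> \<le> sqrt (real N) * U N \<omega>"
    using assms(2) by (intro mult_right_mono) auto
  then show "\<bar>U N \<omega>\<bar> \<le> sqrt (real N) * U N \<omega>" using assms(2)[of N \<omega>] by simp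
qed

section \<open>From scaled moments to the root error\<close>

lemma ennreal_root_le:
  assumes "x \<le> ennreal r" "0 \<le> r" "0 < p"
  shows "ennreal_root p x \<le> ennreal (r powr (1 / p))"
proof -
  have "x \<noteq> \<infinity>" using assms(1) by (auto simp: top_unique)
  moreover have "enn2real x \<le> r" using assms by (simp add: enn2real_leI)
  then have "enn2real x powr (1 / p) \<le> r powr (1 / p)" using assms by (intro powr_mono2) auto
  ultimately show ?thesis by (simp add: ennreal_root_def ennreal_leI)
qed

lemma powr_le_one_plus_power:
  fixes t p :: real
  assumes "0 \<le> t" "0 \<le> p" "p \<le> real n"
  shows "t powr p \<le> 1 + t ^ n"
proof (cases "t \<le> 1")
  case True
  then have "t powr p \<le> 1" using assms by (intro powr_le1) auto
  moreover have "0 \<le> t ^ n" using assms by simp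
  ultimately show ?thesis by linarith
next
  case False
  then have "t powr p \<le> t powr real n" using assms by (intro powr_mono) auto
  also have "\<dots> = t ^ n" using False by (simp add: powr_realpow)
  finally show ?thesis by linarith
qed

text \<open>A real exponent p is dominated by the integer n = ceiling of p. Scaling the distance by
  s = sqrt N leaves a factor s^(-p) outside the expectation, and its p-th root 1/s cancels the sqrt
  N in front.\<close>

lemma (in prob_space) ensemble_error_bounded:
  fixes X :: "nat \<Rightarrow> nat \<Rightarrow> 'a \<Rightarrow> real ^ 'd"
  assumes mb: "moment_bounded M particles
      (\<lambda>j \<omega>. sqrt (real (fst j)) * norm (X (fst j) (snd j) \<omega> - Z (snd j) \<omega>))"
    and p: "p \<ge> 2"
  shows "(SUP N\<in>{2..}. ennreal (sqrt (real N)) * ensemble_error M N p (X N) Z) < \<infinity>"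
proof -
  obtain V where V: "\<And>j. j \<in> particles \<Longrightarrow> V j \<in> borel_measurable M"
    "\<And>j \<omega>. j \<in> particles \<Longrightarrow> \<omega> \<in> space M \<Longrightarrow>
      \<bar>sqrt (real (fst j)) * norm (X (fst j) (snd j) \<omega> - Z (snd j) \<omega>)\<bar> \<le> V j \<omega>"
    "\<And>j \<omega>. j \<in> particles \<Longrightarrow> \<omega> \<in> space M \<Longrightarrow> 0 \<le> V j \<omega>"
    "\<And>n::nat. \<exists>c\<ge>0. \<forall>j\<in>particles. (\<integral>\<^sup>+\<omega>. ennreal (V j \<omega> ^ n) \<partial>M) \<le> ennreal c"
    using mb by (rule moment_boundedE) blast
  define n where "n = nat \<lceil>p\<rceil>"
  have n: "p \<le> real n" unfolding n_def by linarith
  obtain c where c: "c \<ge> 0" "\<And>j. j\<in>particles \<Longrightarrow> (\<integral>\<^sup>+\<omega>. ennreal (V j \<omega> ^ n) \<partial>M) \<le> ennreal c"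
    using V(4) by blast
  have "ennreal (sqrt (real N)) * ensemble_error M N p (X N) Z \<le> ennreal ((1 + c) powr (1 / p))"
    if N: "N \<in> {2..}" for N
  proof -
    define s where "s = sqrt (real N)"
    have s: "s > 0" using N by (simp add: s_def)
    \<comment> \<open>Weight of one particle: s^(-p) undoes the scaling inside the power, and 1/N
      averages.\<close>
    define q where "q = s powr (- p) / real N"
    have q: "0 \<le> q" by (simp add: q_def)
    have j: "(N, i) \<in> particles" if "i \<in> {1..N}" for i using N that by (simp add: particles_def)
    have meas: "(\<lambda>\<omega>. ennreal (V (N, i) \<omega> ^ n)) \<in> borel_measurable M" if "i \<in> {1..N}" for i
      using V(1)[OF j[OF that]] by measurable
    have "(\<integral>\<^sup>+\<omega>. ennreal (1 / real N * (\<Sum>i=1..N. norm (X N i \<omega> - Z i \<omega>) powr p)) \<partial>M)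
      \<le> (\<integral>\<^sup>+\<omega>. (\<Sum>i=1..N. ennreal q * (1 + ennreal (V (N, i) \<omega> ^ n))) \<partial>M)"
    proof (rule nn_integral_mono)
      fix \<omega> assume \<omega>: "\<omega> \<in> space M"
      have le: "norm (X N i \<omega> - Z i \<omega>) powr p / real N \<le> q * (1 + V (N, i) \<omega> ^ n)"
        if "i \<in> {1..N}" for i
      proof -
        let ?e = "norm (X N i \<omega> - Z i \<omega>)"
        have "(s * ?e) powr p \<le> 1 + (s * ?e) ^ n"
          using s p n by (intro powr_le_one_plus_power) auto
        also have "\<dots> \<le> 1 + V (N, i) \<omega> ^ n"
          using V(2)[OF j[OF that] \<omega>] s by (intro add_left_mono power_mono) (auto simp: s_def)
        finally have "s powr p * ?e powr p \<le> 1 + V (N, i) \<omega> ^ n"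
          using s by (simp add: powr_mult)
        then have "s powr (- p) * (s powr p * ?e powr p) \<le> s powr (- p) * (1 + V (N, i) \<omega> ^ n)"
          by (rule mult_left_mono) simp
        moreover have "s powr (- p) * (s powr p * ?e powr p) = ?e powr p"
          using s by (simp add: powr_minus field_simps)
        ultimately show ?thesis
          using divide_right_mono[of "?e powr p" "s powr (- p) * (1 + V (N, i) \<omega> ^ n)" "real N"]
          by (simp add: q_def)
      qed
      have nonneg: "0 \<le> V (N, i) \<omega> ^ n" if "i \<in> {1..N}" for i
        using V(3)[OF j[OF that] \<omega>] by simp
      have "1 / real N * (\<Sum>i=1..N. norm (X N i \<omega> - Z i \<omega>) powr p)
          \<le> (\<Sum>i=1..N. q * (1 + V (N, i) \<omega> ^ n))"
        using sum_mono[where K = "{1..N}", OF le] by (simp add: sum_divide_distrib)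
      then have "ennreal (1 / real N * (\<Sum>i=1..N. norm (X N i \<omega> - Z i \<omega>) powr p))
          \<le> ennreal (\<Sum>i=1..N. q * (1 + V (N, i) \<omega> ^ n))" by (rule ennreal_leI)
      also have "\<dots> = (\<Sum>i=1..N. ennreal (q * (1 + V (N, i) \<omega> ^ n)))"
        using q nonneg by (intro sum_ennreal[symmetric] mult_nonneg_nonneg add_nonneg_nonneg) auto
      also have "\<dots> = (\<Sum>i=1..N. ennreal q * (1 + ennreal (V (N, i) \<omega> ^ n)))"
        using q nonneg by (intro sum.cong refl) (simp add: ennreal_mult)
      finally show "ennreal (1 / real N * (\<Sum>i=1..N. norm (X N i \<omega> - Z i \<omega>) powr p))
          \<le> (\<Sum>i=1..N. ennreal q * (1 + ennreal (V (N, i) \<omega> ^ n)))" .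
    qed
    also have "\<dots> = (\<Sum>i=1..N. ennreal q * (1 + (\<integral>\<^sup>+\<omega>. ennreal (V (N, i) \<omega> ^ n) \<partial>M)))"
    proof (subst nn_integral_sum)
      show "(\<Sum>i=1..N. (\<integral>\<^sup>+\<omega>. ennreal q * (1 + ennreal (V (N, i) \<omega> ^ n)) \<partial>M))
        = (\<Sum>i=1..N. ennreal q * (1 + (\<integral>\<^sup>+\<omega>. ennreal (V (N, i) \<omega> ^ n) \<partial>M)))"
        using meas
        by (intro sum.cong refl) (simp add: nn_integral_cmult nn_integral_add emeasure_space_1)
    qed (use meas in measurable)
    also have "\<dots> \<le> (\<Sum>i=1..N. ennreal q * ennreal (1 + c))"
      using c by (intro sum_mono mult_left_mono) (auto simp: ennreal_plus intro!: c(2) j)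
    also have "\<dots> = ennreal (s powr (- p) * (1 + c))"
    proof -
      have "(\<Sum>i=1..N. ennreal q * ennreal (1 + c)) = (\<Sum>i=1..N. ennreal (q * (1 + c)))"
        using q c by (simp add: ennreal_mult)
      also have "\<dots> = ennreal (\<Sum>i=1..N. q * (1 + c))" using q c by (intro sum_ennreal) simp
      also have "(\<Sum>i=1..N. q * (1 + c)) = s powr (- p) * (1 + c)"
        using N by (simp add: q_def)
      finally show ?thesis .
    qed
    finally have "ensemble_error M N p (X N) Z \<le> ennreal ((s powr (- p) * (1 + c)) powr (1 / p))"
      unfolding ensemble_error_def using c p by (intro ennreal_root_le) auto
    also have "(s powr (- p) * (1 + c)) powr (1 / p) = (1 + c) powr (1 / p) / s"
    proof -
      have "- p * (1 / p) = - 1" using p by simp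
      then have "(s powr (- p)) powr (1 / p) = 1 / s"
        using s by (simp only: powr_powr powr_neg_one)
      then show ?thesis using c by (simp add: powr_mult)
    qed
    finally have "ennreal s * ensemble_error M N p (X N) Z \<le> ennreal s * ennreal ((1 + c) powr (1 / p) / s)"
      by (rule mult_left_mono) simp
    also have "\<dots> = ennreal ((1 + c) powr (1 / p))"
      using s by (simp add: ennreal_mult[symmetric])
    finally show ?thesis by (simp add: s_def)
  qed
  then have "(SUP N\<in>{2..}. ennreal (sqrt (real N)) * ensemble_error M N p (X N) Z)
      \<le> ennreal ((1 + c) powr (1 / p))" by (rule SUP_least)
  then show ?thesis by (simp add: order_le_less_trans)
qed

context filter_model
begin

section \<open>Law of large numbers for the copies\<close>

lemma ens_mean_deviation:
  assumes k: "k \<ge> 1"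
  shows "moment_bounded M {2..} (\<lambda>N \<omega>. sqrt (real N) * norm (ens_mean N (\<lambda>i. copy_f k i \<omega>) - fmean k))"
  unfolding ens_mean_def
proof (rule moment_bounded_average_deviation[OF copy_f_indep_vars[OF k]])
  show "moment_bounded M {1..} (\<lambda>i \<omega>. norm (copy_f k i \<omega>))"
    using mean_field_moments(2)[of "k - 1"] k by simp
  show "expectation (copy_f k i) = fmean k" if "i \<ge> 1" for i
    using mean_field_mean_cov(1)[OF k that] by (simp add: law_mean_def)
qed

text \<open>Centering at the true mean \<open>fmean k\<close> keeps the summands independent and
  makes their expectation exactly \<open>fcov k\<close>.\<close>

lemma ens_cov_deviation:
  assumes k: "k \<ge> 1"
  shows "moment_bounded M {2..} (\<lambda>N \<omega>. sqrt (real N) *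
    norm ((1 / real N) *\<^sub>R (\<Sum>i=1..N. outer (copy_f k i \<omega> - fmean k) (copy_f k i \<omega> - fmean k)) - fcov k))"
proof (rule moment_bounded_average_deviation)
  have "(\<lambda>x. outer (x - m) (x - m)) \<in> borel_measurable borel" for m :: "real ^ 'd"
    by (intro borel_measurable_continuous_onI outer.continuous_on continuous_intros)
  then show "indep_vars (\<lambda>_. borel) (\<lambda>i \<omega>. outer (copy_f k i \<omega> - fmean k) (copy_f k i \<omega> - fmean k)) {1..}"
    by (intro indep_vars_compose2[OF copy_f_indep_vars[OF k]])
  show "moment_bounded M {1..} (\<lambda>i \<omega>. norm (outer (copy_f k i \<omega> - fmean k) (copy_f k i \<omega> - fmean k)))"
  proof (rule moment_bounded_mono)
    have "moment_bounded M {1..} (\<lambda>i \<omega>. norm (copy_f k i \<omega>))"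
      using mean_field_moments(2)[of "k - 1"] k by simp
    then show "moment_bounded M {1..}
        (\<lambda>i \<omega>. (norm (copy_f k i \<omega>) + norm (fmean k)) * (norm (copy_f k i \<omega>) + norm (fmean k)))"
      by (intro moment_bounded_mult moment_bounded_add moment_bounded_const)
    show "\<bar>norm (outer (copy_f k i \<omega> - fmean k) (copy_f k i \<omega> - fmean k))\<bar>
      \<le> (norm (copy_f k i \<omega>) + norm (fmean k)) * (norm (copy_f k i \<omega>) + norm (fmean k))" for i \<omega>
      unfolding norm_outer abs_mult abs_norm_cancel
      by (intro mult_mono norm_triangle_ineq4) auto
  qed
  show "expectation (\<lambda>\<omega>. outer (copy_f k i \<omega> - fmean k) (copy_f k i \<omega> - fmean k)) = fcov k"
    if "i \<ge> 1" for i
    using mean_field_mean_cov[OF k that] by (simp add: law_cov_def)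
qed

definition ens_a :: "nat \<Rightarrow> nat \<Rightarrow> nat \<Rightarrow> 'w \<Rightarrow> real ^ 'd" where
  "ens_a k N i \<omega> = esrf_a B C H R T Y N (\<lambda>j. X0 j \<omega>) (\<lambda>l j. W l j \<omega>) k i"

definition ens_f :: "nat \<Rightarrow> nat \<Rightarrow> nat \<Rightarrow> 'w \<Rightarrow> real ^ 'd" where
  "ens_f k N i \<omega> = esrf_f B C H R T Y N (\<lambda>j. X0 j \<omega>) (\<lambda>l j. W l j \<omega>) k i"

lemma ens_f_Suc: "ens_f (Suc k) N i \<omega> = B (ens_a k N i \<omega>) + C *v W (Suc k) i \<omega>"
  by (simp add: ens_f_def ens_a_def esrf_f_def forecast_map_def)

lemma ens_a_Suc: "ens_a (Suc k) N i \<omega> =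
    analysis_map H R T (Y (Suc k)) (ens_mean N (\<lambda>i. ens_f (Suc k) N i \<omega>))
      (ens_cov N (\<lambda>i. ens_f (Suc k) N i \<omega>)) (ens_f (Suc k) N i \<omega>)"
  by (simp add: ens_f_Suc forecast_map_def ens_a_def Let_def)

text \<open>Synchronous coupling: particle and copy receive the same noise, which cancels, so only
  the Lipschitz constant of \<open>B\<close> remains.\<close>

lemma forecast_error_step:
  assumes "moment_bounded M particles
      (\<lambda>j \<omega>. sqrt (real (fst j)) * norm (ens_a k (fst j) (snd j) \<omega> - copy_a k (snd j) \<omega>))"
  shows "moment_bounded M particles
      (\<lambda>j \<omega>. sqrt (real (fst j)) * norm (ens_f (Suc k) (fst j) (snd j) \<omega> - copy_f (Suc k) (snd j) \<omega>))"
proof (rule moment_bounded_mono[OF moment_bounded_cmult[OF assms, of L]])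
  fix j \<omega>
  have "norm (ens_f (Suc k) (fst j) (snd j) \<omega> - copy_f (Suc k) (snd j) \<omega>)
      \<le> L * norm (ens_a k (fst j) (snd j) \<omega> - copy_a k (snd j) \<omega>)"
    using lipschitz_onD[OF B_Lipschitz] by (simp add: ens_f_Suc copy_f_Suc dist_norm)
  then have "sqrt (real (fst j)) * norm (ens_f (Suc k) (fst j) (snd j) \<omega> - copy_f (Suc k) (snd j) \<omega>)
      \<le> sqrt (real (fst j)) * (L * norm (ens_a k (fst j) (snd j) \<omega> - copy_a k (snd j) \<omega>))"
    by (rule mult_left_mono) simp
  then show "\<bar>sqrt (real (fst j)) * norm (ens_f (Suc k) (fst j) (snd j) \<omega> - copy_f (Suc k) (snd j) \<omega>)\<bar>
      \<le> L * (sqrt (real (fst j)) * norm (ens_a k (fst j) (snd j) \<omega> - copy_a k (snd j) \<omega>))"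
    by (simp add: mult_ac)
qed

lemma analysis_error_step:
  assumes err: "moment_bounded M particles
      (\<lambda>j \<omega>. sqrt (real (fst j)) * norm (ens_f (Suc k) (fst j) (snd j) \<omega> - copy_f (Suc k) (snd j) \<omega>))"
  shows "moment_bounded M particles
      (\<lambda>j \<omega>. sqrt (real (fst j)) * norm (ens_a (Suc k) (fst j) (snd j) \<omega> - copy_a (Suc k) (snd j) \<omega>))"
proof -
  define m P where "m = fmean (Suc k)" and "P = fcov (Suc k)"
  have psd: "pos_semidef P" by (simp add: P_def fcov_def pos_semidef_law_cov)
  obtain c where c: "0 \<le> c" "\<And>m' P' x z. pos_semidef P' \<Longrightarrow>
    norm (analysis_map H R T (Y (Suc k)) m' P' x - analysis_map H R T (Y (Suc k)) m P z)
      \<le> c * ((1 + norm (P' - P)) ^ 3 *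
          (norm (x - z) + (norm (m' - m) + norm (P' - P)) * (1 + norm (m' - m) + norm (z - m))))"
    using analysis_map_stability[OF R_pos_def psd L\<^sub>T_pos T_Lipschitz, where y = "Y (Suc k)" and m = m] by metis
  define e where "e N i \<omega> = norm (ens_f (Suc k) N i \<omega> - copy_f (Suc k) i \<omega>)" for N i \<omega>
  define \<zeta> where "\<zeta> i \<omega> = norm (copy_f (Suc k) i \<omega> - m)" for i \<omega>
  define d where "d N \<omega> = norm (ens_mean N (\<lambda>i. ens_f (Suc k) N i \<omega>) - m)" for N \<omega>
  define \<delta> where "\<delta> N \<omega> = norm (ens_cov N (\<lambda>i. ens_f (Suc k) N i \<omega>) - P)" for N \<omega>
  define \<epsilon>m where "\<epsilon>m N \<omega> = norm (ens_mean N (\<lambda>i. copy_f (Suc k) i \<omega>) - m)" for N \<omega>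
  define \<epsilon>P where "\<epsilon>P N \<omega> = norm ((1 / real N) *\<^sub>R
    (\<Sum>i=1..N. outer (copy_f (Suc k) i \<omega> - m) (copy_f (Suc k) i \<omega> - m)) - P)" for N \<omega>
  have nonneg: "0 \<le> e N i \<omega>" "0 \<le> \<zeta> i \<omega>" "0 \<le> d N \<omega>" "0 \<le> \<delta> N \<omega>" "0 \<le> \<epsilon>m N \<omega>" "0 \<le> \<epsilon>P N \<omega>"
    for N i \<omega> by (simp_all add: e_def \<zeta>_def d_def \<delta>_def \<epsilon>m_def \<epsilon>P_def)
  have mb_e: "moment_bounded M particles (\<lambda>j \<omega>. sqrt (real (fst j)) * e (fst j) (snd j) \<omega>)"
    using err by (simp add: e_def)
  have mb_\<epsilon>: "moment_bounded M {2..} (\<lambda>N \<omega>. sqrt (real N) * \<epsilon>m N \<omega>)"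
    "moment_bounded M {2..} (\<lambda>N \<omega>. sqrt (real N) * \<epsilon>P N \<omega>)"
    using ens_mean_deviation[of "Suc k"] ens_cov_deviation[of "Suc k"]
    by (simp_all add: \<epsilon>m_def \<epsilon>P_def m_def P_def)
  have "moment_bounded M {1..} (\<lambda>i \<omega>. \<zeta> i \<omega>)"
  proof (rule moment_bounded_mono)
    show "moment_bounded M {1..} (\<lambda>i \<omega>. norm (copy_f (Suc k) i \<omega>) + norm m)"
      by (intro moment_bounded_add moment_bounded_const mean_field_moments)
  qed (simp add: \<zeta>_def norm_triangle_ineq4)
  then have mb_\<zeta>: "moment_bounded M particles (\<lambda>j \<omega>. \<zeta> (snd j) \<omega>)"
    by (rule moment_bounded_reindex) (auto simp: particles_def)
  \<comment> \<open>Quantities of the whole ensemble are read as families over particles, constant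
    in the particle number, so that they can be multiplied with particle errors.\<close>
  have lift: "moment_bounded M particles (\<lambda>j. U (fst j))" if "moment_bounded M {2..} U" for U
    using that by (rule moment_bounded_reindex) (auto simp: particles_def)
  have mb_sd: "moment_bounded M {2..} (\<lambda>N \<omega>. sqrt (real N) * d N \<omega>)"
  proof (rule moment_bounded_mono)
    show "moment_bounded M {2..}
      (\<lambda>N \<omega>. (\<Sum>i=1..N. sqrt (real N) * e N i \<omega>) / real N + sqrt (real N) * \<epsilon>m N \<omega>)"
      by (intro moment_bounded_add mb_\<epsilon> moment_bounded_average mb_e)
    fix N \<omega>
    have "d N \<omega> \<le> (\<Sum>i=1..N. e N i \<omega>) / real N + \<epsilon>m N \<omega>"
      unfolding d_def e_def \<epsilon>m_def by (rule norm_ens_mean_diff_le)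
    then have "sqrt (real N) * d N \<omega> \<le> sqrt (real N) * ((\<Sum>i=1..N. e N i \<omega>) / real N + \<epsilon>m N \<omega>)"
      by (rule mult_left_mono) simp
    then show "\<bar>sqrt (real N) * d N \<omega>\<bar>
      \<le> (\<Sum>i=1..N. sqrt (real N) * e N i \<omega>) / real N + sqrt (real N) * \<epsilon>m N \<omega>"
      using nonneg(3)[of N \<omega>] by (simp add: distrib_left sum_distrib_left)
  qed
  have mb_d: "moment_bounded M {2..} d"
    using mb_sd nonneg(3) by (rule moment_bounded_of_sqrt_multiple)
  \<comment> \<open>The quadratic terms would need only one factor sqrt N. Allowing it on both
    factors is harmless and expresses the bound through quantities already controlled.\<close>
  have mb_s\<delta>: "moment_bounded M {2..} (\<lambda>N \<omega>. sqrt (real N) * \<delta> N \<omega>)"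
  proof (rule moment_bounded_mono)
    show "moment_bounded M {2..} (\<lambda>N \<omega>. 2 * (sqrt (real N) * \<epsilon>P N \<omega>
      + (\<Sum>i=1..N. sqrt (real N) * e N i \<omega> * (sqrt (real N) * e N i \<omega> + 2 * \<zeta> i \<omega>)) / real N
      + sqrt (real N) * d N \<omega> * (sqrt (real N) * d N \<omega>) + norm P))"
      by (intro moment_bounded_cmult moment_bounded_add moment_bounded_average moment_bounded_mult
          mb_\<epsilon> mb_e mb_sd mb_\<zeta> moment_bounded_const)
    fix N :: nat and \<omega> assume "N \<in> {2..}"
    then have N: "2 \<le> N" by simp
    define s where "s = sqrt (real N)"
    have s: "1 \<le> s" "s * s = real N" using N by (simp_all add: s_def)
    have "\<delta> N \<omega> \<le> 2 * (\<epsilon>P N \<omega> + (\<Sum>i=1..N. e N i \<omega> * (e N i \<omega> + 2 * \<zeta> i \<omega>)) / real N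
        + (d N \<omega>)\<^sup>2 + norm P / real N)"
      unfolding \<delta>_def \<epsilon>P_def e_def \<zeta>_def d_def by (rule norm_ens_cov_diff_le[OF N])
    then have "s * \<delta> N \<omega> \<le> s * (2 * (\<epsilon>P N \<omega> + (\<Sum>i=1..N. e N i \<omega> * (e N i \<omega> + 2 * \<zeta> i \<omega>)) / real N
        + (d N \<omega>)\<^sup>2 + norm P / real N))"
      using s by (intro mult_left_mono) auto
    also have "\<dots> = 2 * (s * \<epsilon>P N \<omega> + (\<Sum>i=1..N. s * (e N i \<omega> * (e N i \<omega> + 2 * \<zeta> i \<omega>))) / real N
        + s * (d N \<omega>)\<^sup>2 + s * norm P / real N)"
      unfolding sum_distrib_left[symmetric] by (simp only: distrib_left times_divide_eq_right mult.left_commute)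
    also have "\<dots> \<le> 2 * (s * \<epsilon>P N \<omega> + (\<Sum>i=1..N. s * e N i \<omega> * (s * e N i \<omega> + 2 * \<zeta> i \<omega>)) / real N
        + s * d N \<omega> * (s * d N \<omega>) + norm P)"
    proof (intro mult_left_mono add_mono divide_right_mono sum_mono order_refl)
      fix i
      have "e N i \<omega> \<le> s * e N i \<omega>" using s nonneg(1)[of N i \<omega>] mult_right_mono[of 1 s] by simp
      then show "s * (e N i \<omega> * (e N i \<omega> + 2 * \<zeta> i \<omega>)) \<le> s * e N i \<omega> * (s * e N i \<omega> + 2 * \<zeta> i \<omega>)"
        unfolding mult.assoc[symmetric] using s nonneg by (intro mult_left_mono) auto
      have "d N \<omega> \<le> s * d N \<omega>" using s nonneg(3)[of N \<omega>] mult_right_mono[of 1 s] by simp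
      then show "s * (d N \<omega>)\<^sup>2 \<le> s * d N \<omega> * (s * d N \<omega>)"
        unfolding power2_eq_square mult.assoc[symmetric] using s nonneg
        by (metis mult.assoc mult_left_mono mult_nonneg_nonneg order_trans zero_le_one)
      \<comment> \<open>The normalisation term is of order 1/N, smaller than the required rate
        1/sqrt N.\<close>
      have "s \<le> real N" using s mult_right_mono[of 1 s s] by simp
      then have "s * norm P \<le> real N * norm P" by (rule mult_right_mono) simp
      then show "s * norm P / real N \<le> norm P" using N by (simp add: divide_le_eq mult.commute)
    qed (use s in auto)
    finally show "\<bar>sqrt (real N) * \<delta> N \<omega>\<bar> \<le> 2 * (sqrt (real N) * \<epsilon>P N \<omega>
      + (\<Sum>i=1..N. sqrt (real N) * e N i \<omega> * (sqrt (real N) * e N i \<omega> + 2 * \<zeta> i \<omega>)) / real N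
      + sqrt (real N) * d N \<omega> * (sqrt (real N) * d N \<omega>) + norm P)"
      using nonneg(4)[of N \<omega>] unfolding s_def by simp
  qed
  have mb_\<delta>: "moment_bounded M {2..} \<delta>"
    using mb_s\<delta> nonneg(4) by (rule moment_bounded_of_sqrt_multiple)
  show ?thesis
  proof (rule moment_bounded_mono)
    \<comment> \<open>Here sqrt N is attached to the linear occurrences of e, d and \<delta> only;
      the cube and the last factor use the unscaled bounds.\<close>
    show "moment_bounded M particles (\<lambda>j \<omega>. c * ((1 + \<delta> (fst j) \<omega>) ^ 3 *
      (sqrt (real (fst j)) * e (fst j) (snd j) \<omega> +
       (sqrt (real (fst j)) * d (fst j) \<omega> + sqrt (real (fst j)) * \<delta> (fst j) \<omega>) *
         (1 + d (fst j) \<omega> + \<zeta> (snd j) \<omega>))))"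
      by (intro moment_bounded_cmult moment_bounded_mult moment_bounded_power moment_bounded_add
          moment_bounded_const mb_e mb_\<zeta> lift[OF mb_d] lift[OF mb_\<delta>] lift[OF mb_sd] lift[OF mb_s\<delta>])
    fix j :: "nat \<times> nat" and \<omega> assume j: "j \<in> particles"
    obtain N i where Ni: "j = (N, i)" by (cases j)
    have N: "2 \<le> N" "1 \<le> i" using j by (auto simp: particles_def Ni)
    define s where "s = sqrt (real N)"
    have "norm (ens_a (Suc k) N i \<omega> - copy_a (Suc k) i \<omega>)
      \<le> c * ((1 + \<delta> N \<omega>) ^ 3 * (e N i \<omega> + (d N \<omega> + \<delta> N \<omega>) * (1 + d N \<omega> + \<zeta> i \<omega>)))"
      unfolding ens_a_Suc copy_a_Suc e_def d_def \<delta>_def \<zeta>_def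
      using c(2)[OF pos_semidef_ens_cov[OF N(1)]] mean_field_mean_cov[of "Suc k" i] N(2)
      by (simp add: m_def P_def)
    then have "s * norm (ens_a (Suc k) N i \<omega> - copy_a (Suc k) i \<omega>)
      \<le> s * (c * ((1 + \<delta> N \<omega>) ^ 3 * (e N i \<omega> + (d N \<omega> + \<delta> N \<omega>) * (1 + d N \<omega> + \<zeta> i \<omega>))))"
      by (rule mult_left_mono) (simp add: s_def)
    also have "\<dots> = c * ((1 + \<delta> N \<omega>) ^ 3 *
        (s * e N i \<omega> + (s * d N \<omega> + s * \<delta> N \<omega>) * (1 + d N \<omega> + \<zeta> i \<omega>)))"
      by (simp add: algebra_simps)
    finally show "\<bar>sqrt (real (fst j)) * norm (ens_a (Suc k) (fst j) (snd j) \<omega> - copy_a (Suc k) (snd j) \<omega>)\<bar>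
      \<le> c * ((1 + \<delta> (fst j) \<omega>) ^ 3 *
      (sqrt (real (fst j)) * e (fst j) (snd j) \<omega> +
       (sqrt (real (fst j)) * d (fst j) \<omega> + sqrt (real (fst j)) * \<delta> (fst j) \<omega>) *
         (1 + d (fst j) \<omega> + \<zeta> (snd j) \<omega>)))"
      by (simp add: Ni s_def)
  qed
qed

text \<open>The induction starts from error 0, because ensemble and copies share their initial
  values.\<close>

lemma analysis_error:
  "moment_bounded M particles
    (\<lambda>j \<omega>. sqrt (real (fst j)) * norm (ens_a k (fst j) (snd j) \<omega> - copy_a k (snd j) \<omega>))"
proof (induction k)
  case 0
  then show ?case by (simp add: ens_a_def copy_a_0 moment_bounded_const)
next
  case (Suc k)
  then show ?case by (intro analysis_error_step forecast_error_step)
qed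

lemma forecast_error:
  assumes "k \<ge> 1"
  shows "moment_bounded M particles
    (\<lambda>j \<omega>. sqrt (real (fst j)) * norm (ens_f k (fst j) (snd j) \<omega> - copy_f k (snd j) \<omega>))"
  using forecast_error_step[OF analysis_error, of "k - 1"] assms by simp

end

theorem theorem3p6:
  fixes B :: "real ^ 'd \<Rightarrow> real ^ 'd"
    and C :: "real ^ 'r ^ 'd"
    and H :: "real ^ 'd ^ 'q"
    and R :: "real ^ 'q ^ 'q"
    and \<Gamma> :: "real ^ 's ^ 'q"
    and Y :: "nat \<Rightarrow> real ^ 'q"
    and T :: "real ^ 'd ^ 'd \<Rightarrow> real ^ 'd ^ 'd"
    and C\<^sub>T L\<^sub>T :: real
    and \<P> :: "'w measure"
    and \<pi>\<^sub>0 :: "(real ^ 'd) measure"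
    and X0 :: "nat \<Rightarrow> 'w \<Rightarrow> real ^ 'd"
    and W :: "nat \<Rightarrow> nat \<Rightarrow> 'w \<Rightarrow> real ^ 'r"
  assumes B_Lipschitz: "\<exists>L. L-lipschitz_on UNIV B"
    and Q_pos_def: "pos_def (C ** transpose C)"
    and R_eq: "R = \<Gamma> ** transpose \<Gamma>"
    and R_pos_def: "pos_def R"
    and T_consistent: "sqrt_consistent H R T"
    and constants_pos: "C\<^sub>T > 0" "L\<^sub>T > 0"
    and T1: "\<And>P. pos_semidef P \<Longrightarrow> spectral_norm (T P) \<le> C\<^sub>T * (1 + spectral_norm P)"
    and T2: "\<And>P P'. pos_semidef P \<Longrightarrow> pos_semidef P' \<Longrightarrow>
               spectral_norm (T P - T P')
                 \<le> L\<^sub>T * (1 + (spectral_norm P)\<^sup>2 + (spectral_norm P')\<^sup>2) * spectral_norm (P - P')"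
    and prob: "prob_space \<P>"
    and indep: "jointly_independent \<P> X0 {1..} (\<lambda>(k, i). W k i) ({1..} \<times> {1..})"
    and X0_law: "\<And>i. i \<ge> 1 \<Longrightarrow> distr \<P> borel (X0 i) = \<pi>\<^sub>0"
    and W_law: "\<And>k i. k \<ge> 1 \<Longrightarrow> i \<ge> 1 \<Longrightarrow> standard_gaussian \<P> (W k i)"
    and moments: "\<And>p::real. p \<ge> 2 \<Longrightarrow> integrable \<pi>\<^sub>0 (\<lambda>x. norm x powr p)"
  shows "\<forall>p::real. p \<ge> 2 \<longrightarrow>
    (\<forall>k\<ge>1. (SUP M\<in>{2..}. ennreal (sqrt (real M)) *
        ensemble_error \<P> M p
          (\<lambda>i \<omega>. esrf_f B C H R T Y M (\<lambda>j. X0 j \<omega>) (\<lambda>l j. W l j \<omega>) k i)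
          (\<lambda>i \<omega>. mean_field_f \<P> B C H R T Y (X0 i) (\<lambda>l. W l i) k \<omega>)) < \<infinity>) \<and>
    (\<forall>k. (SUP M\<in>{2..}. ennreal (sqrt (real M)) *
        ensemble_error \<P> M p
          (\<lambda>i \<omega>. esrf_a B C H R T Y M (\<lambda>j. X0 j \<omega>) (\<lambda>l j. W l j \<omega>) k i)
          (\<lambda>i \<omega>. mean_field_a \<P> B C H R T Y (X0 i) (\<lambda>l. W l i) k \<omega>)) < \<infinity>)"
proof -
  obtain L where L: "L-lipschitz_on UNIV B" using B_Lipschitz by blast
  interpret prob_space \<P> by (rule prob)
  interpret filter_model \<P> B C H R T Y L L\<^sub>T \<pi>\<^sub>0 X0 W
    by unfold_locales (fact L R_pos_def constants_pos T2 indep X0_law W_law moments)+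
  show ?thesis
    using ensemble_error_bounded[OF forecast_error] ensemble_error_bounded[OF analysis_error]
    unfolding ens_a_def[abs_def] copy_a_def[abs_def] ens_f_def[abs_def] copy_f_def[abs_def] by blast
qed

end
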